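(* Let $q$ be a prime power and let $b,c$ be positive integers with $b>1$. Let $P_M(c,q^b)$ be the proportion of matrices $X\in \mathrm{M}(c,q^b)$ such that $X_F$ is $f$-primary cyclic for some monic irreducible polynomial $f$ of degree $b$ over $\mathrm{GF}(q)$. Then: (i) $P_M(\infty,q^b):=\lim_{c\to\infty}P_M(c,q^b)$ exists and equals \[P_M(\infty,q^b) = 1-\left(1-\frac{bq^{-b}}{(1-q^{-b})^2}\,\omega(1,q^b)^b\right)^{N(q,b)},\] where $\omega(1,q^b)=\prod_{i=1}^{\infty}(1-q^{-bi})$ and $N(q,b)$ is the number of monic irreducible polynomials of degree $b$ over $\mathrm{GF}(q)$; (ii) there exists a constant $k(q,b)$ (depending only on $q$ and $b$) such that, if $c \geq \left(\frac{\max\{b-1,\, q^b/b\}}{\log (3/4)}\right)^2$, then \[\left|P_M(c,q^b)- P_M(\infty,q^b)\right| < k(q,b)\, q^{-bc}.\]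
   Context: Let $F=\mathrm{GF}(q)$, $K=\mathrm{GF}(q^b)$, $n=bc$. $\mathrm{M}(c,q^b)$ is the algebra of $c\times c$ matrices over $K$, acting on the space $K^c$ of row vectors. Regarding $K^c$ as an $n$-dimensional $F$-vector space $V_F$, each $X\in \mathrm{M}(c,q^b)$ acts as an $F$-linear endomorphism of $V_F$, denoted $X_F$ (equivalently, after choosing an $F$-basis, an element of $\mathrm{M}(n,q)$). For an endomorphism $Y$ of a finite-dimensional $F$-space $V$ and a monic irreducible $f\in F[t]$, the $f$-primary component is $V_f=\ker f(Y)^{\dim V}$. $Y$ is $f$-primary cyclic if $V_f\neq 0$ and the minimal polynomial of $Y|_{V_f}$ equals its characteristic polynomial. $\log$ is the natural logarithm. *)

theory Defs
  imports
    "HOL-Analysis.Infinite_Products"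
    "HOL-Library.Function_Algebras"
    "Jordan_Normal_Form.Char_Poly"
begin

section \<open>Primary cyclic endomorphisms\<close>

text \<open>
  In this section \<open>s\<close> is the scalar multiplication of a vector space. Endomorphisms are functions
  on the ambient type; only their values on the finite-dimensional invariant subspace under
  consideration matter.
\<close>

definition poly_act ::
    "('a::field \<Rightarrow> 'b::ab_group_add \<Rightarrow> 'b) \<Rightarrow> 'a poly \<Rightarrow> ('b \<Rightarrow> 'b) \<Rightarrow> 'b \<Rightarrow> 'b"
  where "poly_act s p Y v = (\<Sum>i\<le>degree p. s (coeff p i) ((Y ^^ i) v))"

definition primary_component ::
    "('a::field \<Rightarrow> 'b::ab_group_add \<Rightarrow> 'b) \<Rightarrow> 'b set \<Rightarrow> ('b \<Rightarrow> 'b) \<Rightarrow> 'a poly \<Rightarrow> 'b set"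
  where "primary_component s V Y f = {v \<in> V. (poly_act s f Y ^^ vector_space.dim s V) v = 0}"

definition annihilates_on ::
    "('a::field \<Rightarrow> 'b::ab_group_add \<Rightarrow> 'b) \<Rightarrow> 'b set \<Rightarrow> ('b \<Rightarrow> 'b) \<Rightarrow> 'a poly \<Rightarrow> bool"
  where "annihilates_on s W Y p \<longleftrightarrow> (\<forall>v\<in>W. poly_act s p Y v = 0)"

definition min_poly_on ::
    "('a::field \<Rightarrow> 'b::ab_group_add \<Rightarrow> 'b) \<Rightarrow> 'b set \<Rightarrow> ('b \<Rightarrow> 'b) \<Rightarrow> 'a poly"
  where "min_poly_on s W Y = (THE p. monic p \<and> annihilates_on s W Y p \<and>
    (\<forall>r. r \<noteq> 0 \<and> annihilates_on s W Y r \<longrightarrow> degree p \<le> degree r))"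

definition ordered_basis ::
    "('a::field \<Rightarrow> 'b::ab_group_add \<Rightarrow> 'b) \<Rightarrow> 'b set \<Rightarrow> 'b list \<Rightarrow> bool"
  where "ordered_basis s W bs \<longleftrightarrow>
    distinct bs \<and> \<not> module.dependent s (set bs) \<and> module.span s (set bs) = W"

definition matrix_wrt ::
    "('a::field \<Rightarrow> 'b::ab_group_add \<Rightarrow> 'b) \<Rightarrow> 'b list \<Rightarrow> ('b \<Rightarrow> 'b) \<Rightarrow> 'a mat"
  where "matrix_wrt s bs Y = mat (length bs) (length bs)
    (\<lambda>(i, j). module.representation s (set bs) (Y (bs ! j)) (bs ! i))"

text \<open>The characteristic polynomial does not depend on the basis, so an arbitrary one is chosen.\<close>

definition char_poly_on ::
    "('a::field \<Rightarrow> 'b::ab_group_add \<Rightarrow> 'b) \<Rightarrow> 'b set \<Rightarrow> ('b \<Rightarrow> 'b) \<Rightarrow> 'a poly"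
  where "char_poly_on s W Y = char_poly (matrix_wrt s (SOME bs. ordered_basis s W bs) Y)"

definition primary_cyclic ::
    "('a::field \<Rightarrow> 'b::ab_group_add \<Rightarrow> 'b) \<Rightarrow> 'b set \<Rightarrow> ('b \<Rightarrow> 'b) \<Rightarrow> 'a poly \<Rightarrow> bool"
  where "primary_cyclic s V Y f \<longleftrightarrow> primary_component s V Y f \<noteq> {0} \<and>
    min_poly_on s (primary_component s V Y f) Y = char_poly_on s (primary_component s V Y f) Y"


section \<open>Matrices over the extension field as endomorphisms over the base field\<close>

text \<open>
  A row vector of length \<open>c\<close> over \<open>K\<close> is a function on \<open>nat\<close> vanishing from \<open>c\<close> on. All lengths
  thus share one type, which is an abelian group under pointwise addition. The base field \<open>F\<close>
  acts on it through an embedding \<open>\<iota>\<close> of \<open>F\<close> into \<open>K\<close>.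
\<close>

definition row_space :: "nat \<Rightarrow> (nat \<Rightarrow> 'k::field) set"
  where "row_space c = {v. \<forall>j\<ge>c. v j = 0}"

definition base_scale :: "('f::field \<Rightarrow> 'k::field) \<Rightarrow> 'f \<Rightarrow> (nat \<Rightarrow> 'k) \<Rightarrow> nat \<Rightarrow> 'k"
  where "base_scale \<iota> a v = (\<lambda>j. \<iota> a * v j)"

definition row_act :: "'k::field mat \<Rightarrow> (nat \<Rightarrow> 'k) \<Rightarrow> nat \<Rightarrow> 'k"
  where "row_act X v = (\<lambda>j. if j < dim_col X then \<Sum>i<dim_row X. v i * X $$ (i, j) else 0)"

lemma vector_space_base_scale:
  assumes "field_hom \<iota>"
  shows "vector_space (base_scale \<iota>)"
proof -
  interpret field_hom \<iota> by fact
  show ?thesis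
    by unfold_locales (auto simp: base_scale_def fun_eq_iff algebra_simps hom_distribs)
qed

lemma subspace_row_space:
  assumes "field_hom \<iota>"
  shows "module.subspace (base_scale \<iota>) (row_space c)"
proof -
  interpret vector_space "base_scale \<iota>" using assms by (rule vector_space_base_scale)
  show ?thesis
    by (auto simp: subspace_def row_space_def base_scale_def)
qed

lemma row_act_in_row_space: "X \<in> carrier_mat c c \<Longrightarrow> row_act X v \<in> row_space c"
  by (auto simp: row_act_def row_space_def)

lemma linear_row_act:
  assumes "field_hom \<iota>"
  shows "Vector_Spaces.linear (base_scale \<iota>) (base_scale \<iota>) (row_act X)"
proof -
  interpret vector_space "base_scale \<iota>" using assms by (rule vector_space_base_scale)
  show ?thesis
    by unfold_locales
      (auto simp: row_act_def base_scale_def fun_eq_iff algebra_simps sum.distrib sum_distrib_left)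
qed


section \<open>Proportions\<close>

definition P_M :: "('f::{field,finite} \<Rightarrow> 'k::{field,finite}) \<Rightarrow> nat \<Rightarrow> nat \<Rightarrow> real"
  where "P_M \<iota> b c =
    real (card {X \<in> carrier_mat c c. \<exists>f. monic f \<and> irreducible f \<and> degree f = b \<and>
      primary_cyclic (base_scale \<iota>) (row_space c) (row_act X) f})
    / real (card (carrier_mat c c :: 'k mat set))"

definition P_M_inf :: "('f::{field,finite} \<Rightarrow> 'k::{field,finite}) \<Rightarrow> nat \<Rightarrow> real"
  where "P_M_inf \<iota> b = lim (P_M \<iota> b)"

definition omega :: "real \<Rightarrow> real \<Rightarrow> real"
  where "omega u Q = (\<Prod>i. 1 - u / Q ^ Suc i)"

definition num_monic_irred :: "'f::{field,finite} itself \<Rightarrow> nat \<Rightarrow> nat"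
  where "num_monic_irred _ b = card {f :: 'f poly. monic f \<and> irreducible f \<and> degree f = b}"

end

theory Submission
  imports Defs
begin

text \<open>
  Let \<open>F\<close> be the base field, \<open>K\<close> the extension field and \<open>Q = q\<^sup>b\<close> the number of elements of \<open>K\<close>. A
  monic irreducible polynomial \<open>f\<close> of degree \<open>b\<close> over \<open>F\<close> splits over \<open>K\<close> into distinct linear factors.
  The \<open>f\<close>-primary component of a matrix \<open>X\<close> over \<open>K\<close> is therefore the sum of the generalised eigenspaces
  of the roots of \<open>f\<close>, and as every root generates \<open>K\<close> over \<open>F\<close>, a Jordan block \<open>K[t]/(t - a)\<^sup>e\<close> is
  isomorphic to \<open>F[t]/(f\<^sup>e)\<close> as a module over \<open>F[t]\<close>. So \<open>X\<close> is \<open>f\<close>-primary cyclic over \<open>F\<close> if and only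
  if there is just one Jordan block for all the roots together: exactly one root is an eigenvalue, and its
  eigenspace has dimension \<open>1\<close> over \<open>K\<close>. The proof of this in \<open>primary_cyclic_row_act_iff\<close> replaces
  Jordan blocks by a comparison of the sizes of the kernels of the powers of \<open>f(X)\<close>.

  It remains to find the joint distribution of the dimensions \<open>d a\<close> of the eigenspaces of a random
  \<open>c \<times> c\<close> matrix, for finitely many \<open>a \<in> K\<close>. This can be done without any classification of matrices,
  by moments. The product over \<open>a\<close> of \<open>(Q ^ d a - 1) * (Q ^ d a - Q) * \<dots> * (Q ^ d a - Q ^ (m a - 1))\<close>
  counts the linearly independent tuples of eigenvectors with \<open>m a\<close> members for the eigenvalue \<open>a\<close>. If
  the tuple is chosen first, a matrix has these eigenvectors with probability \<open>Q ^ (- c m)\<close>, where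
  \<open>m = (\<Sum>a. m a)\<close>. Hence the average of the product is
  \<open>(1 - Q ^ (- c)) * \<dots> * (1 - Q ^ (m - 1 - c))\<close>, which is \<open>mat_average_prod_q_falling\<close>, and it differs
  from \<open>1\<close> by at most \<open>Q ^ (m - c)\<close>.

  Gaussian inversion expresses the event \<open>d a = k a\<close> for all \<open>a\<close> through these moments, with
  coefficients that decay faster than any geometric sequence in \<open>m\<close>. So the probability of the event
  converges with an error of order \<open>Q ^ (- c)\<close>, and the limit is a product over \<open>a\<close>
  (\<open>geometric_rate_eigenspace_dimensions\<close>). By Euler's identity the factor is \<open>\<omega> = omega 1 Q\<close> for dimension
  \<open>0\<close> and \<open>(1 / Q) / (1 - 1 / Q)\<^sup>2 * \<omega>\<close> for dimension \<open>1\<close> (\<open>corank_limit_0\<close>, \<open>corank_limit_1\<close>).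
  Different polynomials have disjoint sets of \<open>b\<close> roots, so in the limit they fail to give a cyclic
  component independently of each other, each with probability
  \<open>1 - b * ((1 / Q) / (1 - 1 / Q)\<^sup>2 * \<omega>) * \<omega> ^ (b - 1)\<close>. Convergence at the rate \<open>Q ^ (- c)\<close> is
  stable under sums and products, which gives the limit and the error bound at the same time.
\<close>

section \<open>Vector spaces over finite fields\<close>

lemma card_field_gt_1: "CARD('a::{field,finite}) > 1"
proof -
  have "card {0, 1 :: 'a} \<le> CARD('a)" by (rule card_mono) auto
  then show ?thesis by simp
qed

locale finite_field_vector_space = vector_space scale
  for scale :: "'a::{field,finite} \<Rightarrow> 'b::ab_group_add \<Rightarrow> 'b" (infixr "\<star>" 75)
begin

lemma card_span_independent:
  assumes "finite B" "independent B"
  shows "card (span B) = CARD('a) ^ card B"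
proof -
  let ?h = "\<lambda>u. \<Sum>v\<in>B. u v \<star> v"
  have "inj_on ?h (B \<rightarrow>\<^sub>E UNIV)"
  proof (rule inj_onI)
    fix u u' assume u: "u \<in> B \<rightarrow>\<^sub>E UNIV" and u': "u' \<in> B \<rightarrow>\<^sub>E UNIV" and eq: "?h u = ?h u'"
    have "(\<Sum>v\<in>B. (u v - u' v) \<star> v) = 0"
      using eq by (simp add: scale_left_diff_distrib sum_subtractf)
    from independentD[OF assms(2,1) order_refl this] have "\<And>v. v \<in> B \<Longrightarrow> u v = u' v" by simp
    then show "u = u'" using u u' by (rule PiE_ext[rotated 2]) 
  qed
  moreover have "?h ` (B \<rightarrow>\<^sub>E UNIV) = span B"
  proof -
    have "?h u \<in> ?h ` (B \<rightarrow>\<^sub>E UNIV)" for u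
      by (rule image_eqI[of _ _ "restrict u B"]) (auto intro!: sum.cong)
    then show ?thesis by (auto simp: span_finite[OF assms(1)])
  qed
  ultimately have "bij_betw ?h (B \<rightarrow>\<^sub>E UNIV) (span B)" by (simp add: bij_betw_def)
  then have "card (span B) = card (B \<rightarrow>\<^sub>E (UNIV :: 'a set))" by (rule bij_betw_same_card[symmetric])
  also have "\<dots> = CARD('a) ^ card B" using assms(1) by (simp add: card_PiE)
  finally show ?thesis .
qed

lemma subspace_basis:
  assumes "finite V" "subspace V"
  obtains B where "finite B" "B \<subseteq> V" "independent B" "span B = V" "card B = dim V"
proof -
  obtain B where B: "B \<subseteq> V" "independent B" "V \<subseteq> span B" "card B = dim V" by (rule basis_exists)
  then have "finite B" "span B = V" using assms by (auto intro: finite_subset dest: span_minimal)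
  with B that show ?thesis by blast
qed

lemma card_subspace:
  assumes "finite V" "subspace V"
  shows "card V = CARD('a) ^ dim V"
proof -
  obtain B where B: "finite B" "B \<subseteq> V" "independent B" "span B = V" "card B = dim V"
    by (rule subspace_basis[OF assms])
  from card_span_independent[OF B(1,3)] show ?thesis by (simp only: B(4,5))
qed

lemma card_subspace_psubset:
  assumes "finite V" "subspace V" "subspace U" "U \<subset> V"
  shows "CARD('a) * card U \<le> card V"
proof -
  have U: "card U = CARD('a) ^ dim U" using assms by (auto intro!: card_subspace finite_subset[of U V])
  have V: "card V = CARD('a) ^ dim V" using assms by (simp add: card_subspace)
  have "card U < card V" using assms psubset_card_mono by blast
  then have "dim U < dim V" using card_field_gt_1[where 'a = 'a] by (simp add: U V)
  then have "CARD('a) ^ Suc (dim U) \<le> CARD('a) ^ dim V"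
    by (intro power_increasing) (auto simp: Suc_le_eq)
  then show ?thesis by (simp add: U V)
qed

end

section \<open>The action of polynomials on a vector space with an endomorphism\<close>

lemma coprime_poly_bezout:
  fixes p r :: "'a::field poly"
  assumes "coprime p r"
  shows "\<exists>a b. a * p + b * r = 1"
  using assms
proof (induction "if r = 0 then 0 else Suc (degree r)" arbitrary: p r rule: less_induct)
  case less
  show ?case
  proof (cases "r = 0")
    case True
    with less.prems have "p dvd 1" by simp
    then obtain c where "1 = p * c" by (rule dvdE)
    then have "c * p + 0 * r = 1" by (simp add: mult.commute)
    then show ?thesis by blast
  next
    case False
    have "coprime r (p mod r)"
    proof (rule coprimeI)
      fix d assume d: "d dvd r" "d dvd p mod r"
      then have "d dvd p" by (simp add: dvd_mod_iff)
      with less.prems show "is_unit d" using d(1) by (rule coprime_common_divisor)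
    qed
    moreover have "(if p mod r = 0 then 0 else Suc (degree (p mod r))) < (if r = 0 then 0 else Suc (degree r))"
      using False degree_mod_less[of r p] by auto
    ultimately obtain a b where "a * r + b * (p mod r) = 1" using less.hyps by blast
    then have "a * r + b * (p - p div r * r) = 1" by (simp add: minus_div_mult_eq_mod)
    then have "b * p + (a - b * (p div r)) * r = 1" by (simp add: algebra_simps)
    then show ?thesis by blast
  qed
qed

lemma irreducible_imp_coprime_poly:
  fixes p r :: "'a::field poly"
  assumes "irreducible p" "\<not> p dvd r"
  shows "coprime p r"
proof (rule coprimeI)
  fix d assume "d dvd p" "d dvd r"
  then show "is_unit d" using assms irreducibleD'[of p d] dvd_trans by blast
qed

lemma coprime_power_left_poly:
  fixes p r :: "'a::field poly"
  assumes "coprime p r"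
  shows "coprime (p ^ n) r"
proof -
  obtain a b where "a * p + b * r = 1" using coprime_poly_bezout[OF assms] by blast
  then have ap: "a * p = 1 - b * r" by (simp add: algebra_simps)
  show ?thesis
  proof (rule coprimeI)
    fix d assume d: "d dvd p ^ n" "d dvd r"
    have "r dvd 1 - (1 - b * r) ^ n"
    proof (induction n)
      case (Suc n)
      have "1 - (1 - b * r) ^ Suc n = (1 - (1 - b * r) ^ n) + r * (b * (1 - b * r) ^ n)"
        by (simp add: algebra_simps)
      then show ?case using Suc by (simp only: dvd_add dvd_triv_left)
    qed simp
    with d(2) have "d dvd 1 - (1 - b * r) ^ n" by (rule dvd_trans)
    moreover have "d dvd (1 - b * r) ^ n"
      unfolding ap[symmetric] power_mult_distrib using d(1) by simp
    ultimately have "d dvd (1 - (1 - b * r) ^ n) + (1 - b * r) ^ n" by (rule dvd_add)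
    then show "is_unit d" by simp
  qed
qed

lemma card_le_card_image_times_fiber:
  assumes "finite B" "finite A" "h ` A \<subseteq> B" "\<And>y. y \<in> B \<Longrightarrow> card {x \<in> A. h x = y} \<le> n"
  shows "card A \<le> card B * n"
proof -
  have "A = (\<Union>y\<in>B. {x \<in> A. h x = y})" using assms(3) by auto
  then have "card A \<le> (\<Sum>y\<in>B. card {x \<in> A. h x = y})" using card_UN_le[OF assms(1)] by metis
  also have "\<dots> \<le> card B * n" using sum_bounded_above[OF assms(4), of B] by simp
  finally show ?thesis .
qed

text \<open>
  Both the base field and the extension field act on row vectors, and the same map is linear over
  each of them. The locales are therefore parametrised by the scalar multiplication.
\<close>

locale endomorphism = vector_space scale
  for scale :: "'a::field \<Rightarrow> 'b::ab_group_add \<Rightarrow> 'b" (infixr "\<star>" 75) +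
  fixes Y :: "'b \<Rightarrow> 'b"
  assumes linear_Y: "Vector_Spaces.linear scale scale Y"
begin

sublocale Y: Vector_Spaces.linear scale scale Y by (rule linear_Y)

abbreviation act :: "'a poly \<Rightarrow> 'b \<Rightarrow> 'b" where "act p \<equiv> poly_act scale p Y"

lemma act_upto:
  assumes "degree p \<le> n"
  shows "act p v = (\<Sum>i\<le>n. coeff p i \<star> (Y ^^ i) v)"
  unfolding poly_act_def
  by (rule sum.mono_neutral_left) (use assms in \<open>auto simp: coeff_eq_0\<close>)

lemma act_0 [simp]: "act 0 v = 0"
  by (simp add: poly_act_def)

lemma act_pCons [simp]: "act (pCons a p) v = a \<star> v + Y (act p v)"
proof -
  have "act (pCons a p) v = (\<Sum>i\<le>Suc (degree p). coeff (pCons a p) i \<star> (Y ^^ i) v)"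
    by (rule act_upto) (rule degree_pCons_le)
  then show ?thesis
    by (simp add: sum.atMost_Suc_shift poly_act_def Y.sum Y.scale del: sum.atMost_Suc)
qed

lemma act_add: "act (p + q) v = act p v + act q v"
proof -
  let ?n = "max (degree p) (degree q)"
  have "act (p + q) v = (\<Sum>i\<le>?n. coeff (p + q) i \<star> (Y ^^ i) v)"
    by (rule act_upto) (rule degree_add_le_max)
  also have "\<dots> = act p v + act q v"
    by (simp add: act_upto[of p ?n] act_upto[of q ?n] scale_left_distrib sum.distrib)
  finally show ?thesis .
qed

lemma act_smult: "act (Polynomial.smult a p) v = a \<star> act p v"
  by (induction p) (simp_all add: scale_right_distrib Y.scale)

lemma act_uminus: "act (- p) v = - act p v"
  using act_smult[of "-1" p v] by simp

lemma act_diff: "act (p - q) v = act p v - act q v"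
  using act_add[of p "- q" v] by (simp add: act_uminus)

lemma act_sum: "act (\<Sum>i\<in>I. p i) v = (\<Sum>i\<in>I. act (p i) v)"
  by (induction I rule: infinite_finite_induct) (simp_all add: act_add)

lemma act_1 [simp]: "act 1 v = v"
  by (simp add: one_pCons Y.zero)

lemma act_mult: "act (p * q) v = act p (act q v)"
  by (induction p) (simp_all add: act_add act_smult)

lemma act_commute: "act p (act q v) = act q (act p v)"
  by (metis act_mult mult.commute)

lemma act_power: "act (p ^ n) v = (act p ^^ n) v"
  by (induction n arbitrary: v) (simp_all add: act_mult)

lemma act_arg_add: "act p (u + v) = act p u + act p v"
  by (induction p) (simp_all add: scale_right_distrib Y.add algebra_simps)

lemma act_arg_scale: "act p (a \<star> v) = a \<star> act p v"
  by (induction p) (simp_all add: scale_right_distrib Y.scale scale_left_commute)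

lemma linear_act: "Vector_Spaces.linear scale scale (act p)"
  by unfold_locales (simp_all add: act_arg_add act_arg_scale)

lemma act_arg_0 [simp]: "act p 0 = 0"
  using act_arg_scale[of p 0 0] by simp

lemma act_arg_diff: "act p (u - v) = act p u - act p v"
  using act_arg_add[of p "u - v" v] by simp

lemma act_arg_sum: "act p (\<Sum>i\<in>I. f i) = (\<Sum>i\<in>I. act p (f i))"
  by (induction I rule: infinite_finite_induct) (simp_all add: act_arg_add)

lemma act_in_subspace:
  assumes "subspace V" "\<And>v. v \<in> V \<Longrightarrow> Y v \<in> V" "v \<in> V"
  shows "act p v \<in> V"
  by (induction p) (simp_all add: assms subspace_0 subspace_add subspace_scale)

end

locale invariant_subspace = endomorphism +
  fixes V :: "'b set"
  assumes subspace_V: "subspace V" and finite_V: "finite V"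
    and invariant_V: "\<And>v. v \<in> V \<Longrightarrow> Y v \<in> V"
begin

definition kernel :: "'a poly \<Rightarrow> 'b set"
  where "kernel p = {v \<in> V. act p v = 0}"

lemma act_in_V: "v \<in> V \<Longrightarrow> act p v \<in> V"
  using act_in_subspace subspace_V invariant_V by blast

lemma subspace_kernel: "subspace (kernel p)"
  using subspace_V by (auto simp: subspace_def kernel_def act_arg_add act_arg_scale)

lemma finite_kernel: "finite (kernel p)"
  using finite_V by (simp add: kernel_def)

lemma act_in_kernel: "v \<in> kernel p \<Longrightarrow> act q v \<in> kernel p"
  by (auto simp: kernel_def act_in_V act_commute[of p])

lemma Y_in_kernel: "v \<in> kernel p \<Longrightarrow> Y v \<in> kernel p"
  using act_in_kernel[of v p "[:0, 1:]"] by (simp add: Y.zero)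

lemma kernel_1 [simp]: "kernel 1 = {0}"
  using subspace_V subspace_0 by (auto simp: kernel_def)

text \<open>
  If \<open>a * p + b * r = 1\<close>, then \<open>v = (a p)(Y) v + (b r)(Y) v\<close> splits a vector killed by \<open>p r\<close> into
  parts killed by \<open>r\<close> and by \<open>p\<close>. The splitting is unique because a vector killed by both is \<open>0\<close>.
\<close>

lemma card_kernel_mult_coprime:
  assumes "coprime p r"
  shows "card (kernel (p * r)) = card (kernel p) * card (kernel r)"
proof -
  obtain a b where ab: "a * p + b * r = 1" using coprime_poly_bezout[OF assms] by blast
  have split: "v = act (a * p) v + act (b * r) v" for v
    using act_add[of "a * p" "b * r" v] by (simp add: ab)
  have "bij_betw (\<lambda>(u, w). u + w) (kernel p \<times> kernel r) (kernel (p * r))"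
    unfolding bij_betw_def
  proof (intro conjI subset_antisym)
    show "inj_on (\<lambda>(u, w). u + w) (kernel p \<times> kernel r)"
    proof (rule inj_onI, clarify)
      fix u w u' w'
      assume uw: "u \<in> kernel p" "w \<in> kernel r" "u' \<in> kernel p" "w' \<in> kernel r"
        and eq: "u + w = u' + w'"
      have e: "u - u' = w' - w" using eq by (simp add: algebra_simps)
      have "act p (u - u') = 0" using uw by (simp add: kernel_def act_arg_diff)
      moreover have "act r (u - u') = 0" unfolding e using uw by (simp add: kernel_def act_arg_diff)
      ultimately have "u - u' = 0" using split[of "u - u'"] by (simp add: act_mult)
      then show "u = u' \<and> w = w'" using eq by simp
    qed
    have "act (p * r) u = 0" "act (p * r) w = 0" if "act p u = 0" "act r w = 0" for u w
      using that by (metis act_arg_0 act_mult act_commute)+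
    then show "(\<lambda>(u, w). u + w) ` (kernel p \<times> kernel r) \<subseteq> kernel (p * r)"
      using subspace_V by (auto simp: kernel_def act_arg_add subspace_add)
    show "kernel (p * r) \<subseteq> (\<lambda>(u, w). u + w) ` (kernel p \<times> kernel r)"
    proof
      fix v assume v: "v \<in> kernel (p * r)"
      have "act p (act (b * r) v) = act b (act (p * r) v)"
        by (metis act_commute act_mult)
      moreover have "act r (act (a * p) v) = act a (act (p * r) v)"
        by (metis act_commute act_mult mult.commute)
      ultimately have "act (b * r) v \<in> kernel p" "act (a * p) v \<in> kernel r"
        using v by (auto simp: kernel_def act_in_V)
      with split[of v] show "v \<in> (\<lambda>(u, w). u + w) ` (kernel p \<times> kernel r)"
        by (auto intro!: image_eqI[of _ _ "(act (b * r) v, act (a * p) v)"] simp: add.commute)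
    qed
  qed
  from bij_betw_same_card[OF this] show ?thesis by (simp add: card_cartesian_product)
qed

lemma card_kernel_linear_factors:
  assumes "finite S"
  shows "card (kernel (\<Prod>a\<in>S. [:- a, 1:])) = (\<Prod>a\<in>S. card {v \<in> V. Y v = a \<star> v})"
  using assms
proof (induction S)
  case (insert a S)
  have "\<not> [:- a, 1:] dvd (\<Prod>a\<in>S. [:- a, 1:])"
    using insert.hyps by (auto simp: poly_eq_0_iff_dvd[symmetric] poly_prod)
  then have "coprime [:- a, 1:] (\<Prod>a\<in>S. [:- a, 1:])"
    by (intro irreducible_imp_coprime_poly irreducible_linear_field_poly) simp_all
  moreover have "kernel [:- a, 1:] = {v \<in> V. Y v = a \<star> v}"
    by (auto simp: kernel_def Y.zero)
  ultimately show ?case using insert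
    by (simp add: card_kernel_mult_coprime del: mult_pCons_left)
qed simp

lemma kernel_power_mono: "i \<le> j \<Longrightarrow> kernel (p ^ i) \<subseteq> kernel (p ^ j)"
  by (auto simp: kernel_def le_iff_add power_add act_mult act_commute[of "p ^ i"])

lemma kernel_power_stable:
  assumes "kernel (p ^ j) = kernel (p ^ Suc j)" "j \<le> i"
  shows "kernel (p ^ i) = kernel (p ^ j)"
  using assms(2)
proof (induction i rule: dec_induct)
  case (step i)
  have "v \<in> kernel (p ^ j)" if "v \<in> kernel (p ^ Suc i)" for v
  proof -
    have "act (p ^ Suc i) v = act (p ^ i) (act p v)" "act (p ^ Suc j) v = act (p ^ j) (act p v)"
      by (metis act_mult power_Suc2)+
    moreover have "act p v \<in> kernel (p ^ i) \<longleftrightarrow> act p v \<in> kernel (p ^ j)" using step.IH by simp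
    ultimately have "v \<in> kernel (p ^ Suc j)"
      using that by (auto simp: kernel_def act_in_V)
    with assms(1) show ?thesis by simp
  qed
  with kernel_power_mono[of j "Suc i" p] step.hyps show ?case by auto
qed simp

text \<open>
  Each step of the chain \<open>ker p(Y)\<^sup>j\<close> grows by at most a factor \<open>|ker p(Y)|\<close>: the fibres of
  \<open>p(Y)\<close> on the next kernel are translates of subsets of \<open>ker p(Y)\<close>.
\<close>

lemma card_kernel_power_le: "card (kernel (p ^ j)) \<le> card (kernel p) ^ j"
proof (induction j)
  case (Suc j)
  have "card (kernel (p ^ Suc j)) \<le> card (kernel (p ^ j)) * card (kernel p)"
  proof (rule card_le_card_image_times_fiber[OF finite_kernel finite_kernel])
    show "act p ` kernel (p ^ Suc j) \<subseteq> kernel (p ^ j)"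
      by (auto simp: kernel_def act_in_V act_mult act_commute)
    fix y
    show "card {v \<in> kernel (p ^ Suc j). act p v = y} \<le> card (kernel p)"
    proof (cases "{v \<in> kernel (p ^ Suc j). act p v = y} = {}")
      case False
      then obtain u where u: "u \<in> V" "act p u = y" by (auto simp: kernel_def)
      have "(\<lambda>v. v - u) ` {v \<in> kernel (p ^ Suc j). act p v = y} \<subseteq> kernel p"
        using u subspace_V by (auto simp: kernel_def act_arg_diff subspace_diff)
      from card_mono[OF finite_kernel this] show ?thesis by (subst (asm) card_image) (auto simp: inj_on_def)
    qed (simp only: card.empty)
  qed
  also have "\<dots> \<le> card (kernel p) ^ Suc j" using Suc.IH by simp
  finally show ?case .
qed simp

end

section \<open>Minimal and characteristic polynomials\<close>

context invariant_subspace
begin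

lemma ordered_basis_exists: "\<exists>bs. ordered_basis scale V bs"
proof -
  obtain B where B: "B \<subseteq> V" "independent B" "V \<subseteq> span B" by (rule maximal_independent_subset)
  then have "finite B" "span B = V" using finite_V subspace_V by (auto intro: finite_subset dest: span_minimal)
  moreover obtain bs where "set bs = B" "distinct bs" using \<open>finite B\<close> finite_distinct_list by blast
  ultimately show ?thesis using B by (auto simp: ordered_basis_def)
qed

text \<open>
  The characteristic polynomial annihilates by the adjugate argument behind the theorem of Cayley
  and Hamilton. With \<open>M = t I - A\<close>, the columns of \<open>M\<close>, applied to the basis vectors
  through the polynomial action, give \<open>0\<close>. Multiplication by the adjugate of \<open>M\<close> turns these
  relations into \<open>det M\<close> acting as \<open>0\<close> on each basis vector.
\<close>

lemma
  assumes "ordered_basis scale V bs"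
  defines "A \<equiv> matrix_wrt scale bs Y"
  shows degree_monic_char_poly_matrix_wrt: "degree (char_poly A) = dim V \<and> monic (char_poly A)"
    and char_poly_matrix_wrt_annihilates: "annihilates_on scale V Y (char_poly A)"
proof -
  define n where "n = length bs"
  have bs: "distinct bs" "independent (set bs)" "span (set bs) = V"
    using assms(1) by (auto simp: ordered_basis_def)
  have A: "A \<in> carrier_mat n n" by (simp add: A_def matrix_wrt_def n_def)
  have "dim V = card (set bs)" using bs by (metis dim_span_eq_card_independent)
  then have "dim V = n" using bs(1) by (simp add: n_def distinct_card)
  then show "degree (char_poly A) = dim V \<and> monic (char_poly A)"
    using degree_monic_char_poly[OF A] by simp
  define M where "M = char_poly_matrix A"
  define N where "N = adj_mat M"
  have M: "M \<in> carrier_mat n n" using A by (simp add: M_def)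
  have N: "N \<in> carrier_mat n n" "M * N = det M \<cdot>\<^sub>m 1\<^sub>m n" using adj_mat[OF M] by (auto simp: N_def)
  have M_ij: "M $$ (i, j) = (if i = j then [:0, 1:] else 0) + [:- (A $$ (i, j)):]"
    if "i < n" "j < n" for i j
    using that A by (simp add: M_def char_poly_matrix_def)
  have M_relation: "(\<Sum>i<n. act (M $$ (i, j)) (bs ! i)) = 0" if j: "j < n" for j
  proof -
    have "bs ! j \<in> V" using j bs(3) span_base[of "bs ! j" "set bs"] by (auto simp: n_def)
    then have "Y (bs ! j) \<in> span (set bs)" by (simp add: bs(3) invariant_V)
    then have "(\<Sum>v\<in>set bs. representation (set bs) (Y (bs ! j)) v \<star> v) = Y (bs ! j)"
      using bs by (intro sum_representation_eq) auto
    moreover have "(\<Sum>v\<in>set bs. representation (set bs) (Y (bs ! j)) v \<star> v)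
        = (\<Sum>i<n. A $$ (i, j) \<star> bs ! i)"
      using bij_betw_nth[OF bs(1) refl refl] j
      by (subst sum.reindex_bij_betw[symmetric, of "(!) bs" "{..<n}"])
        (auto simp: n_def A_def matrix_wrt_def)
    moreover have "act (M $$ (i, j)) (bs ! i) = (if i = j then Y (bs ! j) else 0) - A $$ (i, j) \<star> bs ! i"
      if "i < n" for i
      using that j by (simp add: M_ij act_add Y.zero)
    ultimately show ?thesis using j by (simp add: sum_subtractf)
  qed
  have basis: "act (det M) (bs ! k) = 0" if k: "k < n" for k
  proof -
    have "act (det M) (bs ! k) = (\<Sum>i<n. act ((M * N) $$ (i, k)) (bs ! i))"
    proof -
      have "act ((M * N) $$ (i, k)) (bs ! i) = (if i = k then act (det M) (bs ! k) else 0)" if "i < n" for i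
        using that k by (simp add: N(2))
      then show ?thesis using k by simp
    qed
    also have "\<dots> = (\<Sum>i<n. \<Sum>j<n. act (N $$ (j, k)) (act (M $$ (i, j)) (bs ! i)))"
    proof (rule sum.cong[OF refl])
      fix i assume i: "i \<in> {..<n}"
      have "(M * N) $$ (i, k) = (\<Sum>j<n. N $$ (j, k) * M $$ (i, j))"
        using i k M N(1) by (simp add: scalar_prod_def atLeast0LessThan mult.commute)
      then show "act ((M * N) $$ (i, k)) (bs ! i) = (\<Sum>j<n. act (N $$ (j, k)) (act (M $$ (i, j)) (bs ! i)))"
        by (simp add: act_sum act_mult)
    qed
    also have "\<dots> = (\<Sum>j<n. act (N $$ (j, k)) (\<Sum>i<n. act (M $$ (i, j)) (bs ! i)))"
      by (subst sum.swap) (simp add: act_arg_sum)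
    also have "\<dots> = 0" by (simp add: M_relation)
    finally show ?thesis .
  qed
  have "act (char_poly A) v = 0" if "v \<in> V" for v
  proof -
    interpret act: Vector_Spaces.linear scale scale "act (char_poly A)" by (rule linear_act)
    have "v \<in> span (set bs)" using that bs(3) by simp
    then show ?thesis
      by (rule act.eq_0_on_span[rotated]) (use basis in \<open>auto simp: in_set_conv_nth n_def char_poly_def M_def\<close>)
  qed
  then show "annihilates_on scale V Y (char_poly A)" by (simp add: annihilates_on_def)
qed

lemma monic_annihilator_unique:
  assumes "monic p" "annihilates_on scale V Y p" "monic p'" "annihilates_on scale V Y p'"
    and "degree p = degree p'"
    and minimal: "\<And>r. r \<noteq> 0 \<Longrightarrow> annihilates_on scale V Y r \<Longrightarrow> degree p \<le> degree r"
  shows "p = p'"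
proof (rule ccontr)
  assume ne: "p \<noteq> p'"
  have "annihilates_on scale V Y (p - p')" using assms by (simp add: annihilates_on_def act_diff)
  with ne minimal have le: "degree p \<le> degree (p - p')" by simp
  have "coeff (p - p') (degree p) = 0" using assms by simp
  moreover have "degree (p - p') = degree p" using le assms(5) degree_diff_le_max[of p p'] by simp
  ultimately have "lead_coeff (p - p') = 0" by (simp only:)
  then have "p - p' = 0" by (simp only: leading_coeff_0_iff)
  with ne show False by simp
qed

text \<open>
  The characteristic polynomial is a monic annihilator of degree \<open>dim V\<close>, so it is the minimal
  polynomial as soon as no smaller annihilator exists.
\<close>

lemma min_poly_eq_char_poly_iff:
  "min_poly_on scale V Y = char_poly_on scale V Y \<longleftrightarrow>
    (\<forall>r. r \<noteq> 0 \<and> annihilates_on scale V Y r \<longrightarrow> dim V \<le> degree r)"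
proof -
  define \<gamma> where "\<gamma> = char_poly_on scale V Y"
  define P where "P p \<longleftrightarrow> monic p \<and> annihilates_on scale V Y p \<and>
    (\<forall>r. r \<noteq> 0 \<and> annihilates_on scale V Y r \<longrightarrow> degree p \<le> degree r)" for p
  have "ordered_basis scale V (SOME bs. ordered_basis scale V bs)"
    using ordered_basis_exists by (rule someI_ex)
  then have \<gamma>: "degree \<gamma> = dim V" "monic \<gamma>" "annihilates_on scale V Y \<gamma>"
    unfolding \<gamma>_def char_poly_on_def
    using degree_monic_char_poly_matrix_wrt char_poly_matrix_wrt_annihilates by blast+
  have unique: "p = p'" if "P p" "P p'" for p p'
  proof (rule monic_annihilator_unique)
    have "p \<noteq> 0" "p' \<noteq> 0" using that by (auto simp: P_def)
    then show "degree p = degree p'" using that by (auto simp: P_def intro: antisym)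
  qed (use that in \<open>auto simp: P_def\<close>)
  have "\<exists>p. P p"
  proof -
    let ?R = "\<lambda>r. r \<noteq> 0 \<and> annihilates_on scale V Y r"
    have "?R \<gamma>" using \<gamma> by auto
    then obtain r where r: "?R r" "\<And>r'. ?R r' \<Longrightarrow> degree r \<le> degree r'"
      using ex_has_least_nat[of ?R \<gamma> degree] by blast
    define p where "p = Polynomial.smult (inverse (lead_coeff r)) r"
    have "P p" using r by (auto simp: P_def p_def annihilates_on_def act_smult)
    then show ?thesis ..
  qed
  then have min: "P (min_poly_on scale V Y)"
    unfolding min_poly_on_def P_def[symmetric] using unique by (intro theI'[of P]) blast
  show ?thesis
  proof
    assume "min_poly_on scale V Y = char_poly_on scale V Y"
    with min \<gamma> show "\<forall>r. r \<noteq> 0 \<and> annihilates_on scale V Y r \<longrightarrow> dim V \<le> degree r"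
      by (simp add: P_def \<gamma>_def)
  next
    assume "\<forall>r. r \<noteq> 0 \<and> annihilates_on scale V Y r \<longrightarrow> dim V \<le> degree r"
    with \<gamma> have "P \<gamma>" by (simp add: P_def)
    with min unique show "min_poly_on scale V Y = char_poly_on scale V Y" by (simp add: \<gamma>_def)
  qed
qed

text \<open>
  If \<open>f\<^sup>s\<close> is the exact power of \<open>f\<close> in \<open>r\<close> and \<open>s < e\<close>, then the cofactor of \<open>f\<^sup>s\<close> in
  \<open>r\<close> is coprime to \<open>f\<^sup>e\<close>, and a Bezout relation shows that already \<open>f\<^sup>s\<close> annihilates.
\<close>

lemma annihilator_prime_power_dvd:
  assumes f: "irreducible f" and e: "annihilates_on scale V Y (f ^ e)"
    and minimal: "\<And>s. s < e \<Longrightarrow> \<not> annihilates_on scale V Y (f ^ s)"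
    and r: "r \<noteq> 0" "annihilates_on scale V Y r"
  shows "f ^ e dvd r"
proof (rule ccontr)
  assume "\<not> f ^ e dvd r"
  define s where "s = (GREATEST s. f ^ s dvd r)"
  have bound: "t < e" if "f ^ t dvd r" for t
    using that \<open>\<not> f ^ e dvd r\<close> by (meson le_imp_power_dvd dvd_trans not_le)
  have s: "f ^ s dvd r" unfolding s_def
    by (rule GreatestI_nat[of _ 0 e]) (use bound in \<open>auto intro: less_imp_le\<close>)
  have "\<not> f ^ Suc s dvd r"
  proof
    assume "f ^ Suc s dvd r"
    then have "Suc s \<le> s" unfolding s_def
      by (rule Greatest_le_nat[of _ _ e]) (use bound in \<open>auto intro: less_imp_le\<close>)
    then show False by simp
  qed
  obtain r' where r': "r = f ^ s * r'" using s by (rule dvdE)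
  have "\<not> f dvd r'" using \<open>\<not> f ^ Suc s dvd r\<close> by (auto simp: r' mult.commute[of f])
  then have "coprime f r'" using f by (rule irreducible_imp_coprime_poly[rotated])
  then have "coprime (f ^ e) r'" by (rule coprime_power_left_poly)
  from coprime_poly_bezout[OF this] obtain a b where ab: "a * f ^ e + b * r' = 1" by blast
  have "act (f ^ s) v = 0" if v: "v \<in> V" for v
  proof -
    have "f ^ s = (a * f ^ s) * f ^ e + b * r"
      using arg_cong[OF ab, of "\<lambda>x. f ^ s * x"] by (simp add: r' algebra_simps)
    then have "act (f ^ s) v = act (a * f ^ s) (act (f ^ e) v) + act b (act r v)"
      by (metis act_add act_mult)
    then show ?thesis using v e r by (simp add: annihilates_on_def)
  qed
  then have "annihilates_on scale V Y (f ^ s)" by (simp add: annihilates_on_def)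
  with minimal[of s] bound[OF s] show False by blast
qed

end

section \<open>Roots of an irreducible polynomial in a finite extension field\<close>

lemma finite_field_power_card:
  fixes a :: "'k::{field,finite}"
  shows "a ^ CARD('k) = a"
proof (cases "a = 0")
  case False
  let ?U = "UNIV - {0 :: 'k}"
  have "bij_betw ((*) a) ?U ?U"
  proof (rule bij_betw_byWitness[of _ "(*) (inverse a)"])
  qed (use False in \<open>auto simp: field_simps\<close>)
  from prod.reindex_bij_betw[OF this, of "\<lambda>x. x"]
  have "a ^ card ?U * \<Prod>?U = \<Prod>?U" by (simp add: prod.distrib)
  moreover have "\<Prod>?U \<noteq> 0" by simp
  ultimately have "a ^ card ?U = 1" by simp
  moreover have "CARD('k) = Suc (card ?U)" using card.remove[of UNIV "0 :: 'k"] by simp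
  ultimately show ?thesis by (simp only: power_Suc mult_1_right)
qed simp

lemma finite_polys_degree_less: "finite {p :: 'f::{field,finite} poly. degree p < n}"
  and card_polys_degree_less: "n > 0 \<Longrightarrow> card {p :: 'f::{field,finite} poly. degree p < n} = CARD('f) ^ n"
proof -
  let ?h = "\<lambda>p :: 'f poly. restrict (coeff p) {..<n}"
  have inj: "inj_on ?h {p. degree p < n}"
  proof (rule inj_onI, rule poly_eqI)
    fix p r :: "'f poly" and i
    assume p: "p \<in> {p. degree p < n}" "r \<in> {p. degree p < n}" and eq: "?h p = ?h r"
    show "coeff p i = coeff r i"
    proof (cases "i < n")
      case True
      then show ?thesis using fun_cong[OF eq, of i] by simp
    next
      case False
      then show ?thesis using p by (simp add: coeff_eq_0)
    qed
  qed
  have sub: "?h ` {p. degree p < n} \<subseteq> ({..<n} \<rightarrow>\<^sub>E UNIV)" by (auto split: if_splits)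
  show "finite {p :: 'f poly. degree p < n}"
    by (rule inj_on_finite[OF inj sub]) (simp add: finite_PiE)
  assume n: "n > 0"
  have "g \<in> ?h ` {p. degree p < n}" if g: "g \<in> {..<n} \<rightarrow>\<^sub>E UNIV" for g
  proof (rule image_eqI)
    let ?p = "Poly (map g [0..<n])"
    have c: "coeff ?p = (\<lambda>i. if i < n then g i else 0)"
      by (rule ext) (simp add: coeff_Poly_eq nth_default_def)
    show "g = ?h ?p" unfolding c using g by (auto simp: fun_eq_iff PiE_def extensional_def)
    have "degree ?p < n" by (rule degree_lessI) (simp_all add: c n del: coeff_Poly_eq)
    then show "?p \<in> {p. degree p < n}" by simp
  qed
  then have "bij_betw ?h {p. degree p < n} ({..<n} \<rightarrow>\<^sub>E UNIV)"
    using inj sub by (auto simp: bij_betw_def)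
  from bij_betw_same_card[OF this] show "card {p :: 'f poly. degree p < n} = CARD('f) ^ n"
    by (simp add: card_PiE)
qed

lemma prime_elem_dvd_prod:
  assumes "prime_elem p" "finite A" "p dvd prod f A"
  shows "\<exists>a\<in>A. p dvd f a"
  using assms(2,3,1) by (induction A) (auto dest: prime_elem_dvd_multD prime_elem_not_unit)

text \<open>
  Fermat's argument in the residue field of \<open>f\<close>: multiplication by \<open>x\<close> permutes the nonzero
  residues, so the product \<open>\<Prod>R\<close> of all of them satisfies \<open>x ^ card R * \<Prod>R = \<Prod>R\<close> modulo \<open>f\<close>, and
  \<open>\<Prod>R\<close> can be cancelled.
\<close>

lemma irreducible_dvd_X_power_card_diff_X:
  fixes f :: "'f::{field,finite} poly"
  assumes f: "irreducible f"
  shows "f dvd [:0, 1:] ^ (CARD('f) ^ degree f) - [:0, 1:]"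
proof -
  define n where "n = degree f"
  define R where "R = {r :: 'f poly. degree r < n} - {0}"
  define x :: "'f poly" where "x = [:0, 1:]"
  have prime: "prime_elem f" using f by (rule field_poly_irreducible_imp_prime)
  have f0: "f \<noteq> 0" using f by auto
  have n: "n > 0"
  proof (rule ccontr)
    assume "\<not> n > 0"
    then have "is_unit f" using f0 by (simp add: n_def is_unit_iff_degree)
    with f irreducible_not_unit show False by blast
  qed
  have small: "p = 0" if "f dvd p" "degree p < n" for p
    using that dvd_imp_degree_le[of f p] by (auto simp: n_def)
  have "card {r :: 'f poly. degree r < n} = Suc (card R)"
    unfolding R_def using n by (intro card.remove finite_polys_degree_less) auto
  then have R: "finite R" "CARD('f) ^ n = Suc (card R)"
    by (auto simp: R_def finite_polys_degree_less card_polys_degree_less[OF n])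
  have factor: "x ^ Suc (card R) - x = x * (x ^ card R - 1)"
    by (simp only: right_diff_distrib power_Suc mult_1_right)
  show ?thesis
    unfolding n_def[symmetric] R(2) x_def[symmetric] factor
  proof (cases "f dvd x")
    case True
    then show "f dvd x * (x ^ card R - 1)" by (rule dvd_mult2)
  next
    case False
    let ?h = "\<lambda>r. (x * r) mod f"
    have inj: "inj_on ?h R"
    proof (rule inj_onI)
      fix r s assume rs: "r \<in> R" "s \<in> R" and "?h r = ?h s"
      then have "f dvd x * (r - s)" by (simp only: mod_eq_dvd_iff right_diff_distrib)
      then have "f dvd r - s" using prime False by (simp only: prime_elem_dvd_mult_iff) simp
      moreover have "degree (r - s) < n" using rs by (auto simp: R_def intro: degree_diff_less)
      ultimately show "r = s" using small[of "r - s"] by simp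
    qed
    have "?h ` R \<subseteq> R"
    proof
      fix t assume "t \<in> ?h ` R"
      then obtain r where t: "t = ?h r" and r: "r \<in> R" by (rule imageE)
      have "\<not> f dvd r" using r small[of r] by (auto simp: R_def)
      then have "\<not> f dvd x * r" using False prime by (simp only: prime_elem_dvd_mult_iff) simp
      then have "t \<noteq> 0" by (simp only: t mod_eq_0_iff_dvd not_False_eq_True)
      moreover have "degree t < n" using degree_mod_less'[of f "x * r"] f0 \<open>t \<noteq> 0\<close>
        unfolding t n_def by blast
      ultimately show "t \<in> R" by (simp add: R_def)
    qed
    then have "?h ` R = R" using R(1) inj by (intro endo_inj_surj)
    with inj have "bij_betw ?h R R" by (rule bij_betw_imageI)
    from prod.reindex_bij_betw[OF this, of "\<lambda>r. r"] have "(\<Prod>r\<in>R. ?h r) = \<Prod>R" .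
    moreover have "(\<Prod>r\<in>R. x * r) mod f = (\<Prod>r\<in>R. ?h r) mod f" by (simp only: mod_prod_eq)
    ultimately have "(\<Prod>r\<in>R. x * r) mod f = \<Prod>R mod f" by (simp only:)
    then have "(x ^ card R * \<Prod>R) mod f = \<Prod>R mod f" by (simp only: prod.distrib prod_constant)
    then have "f dvd (x ^ card R - 1) * \<Prod>R"
      by (simp only: mod_eq_dvd_iff left_diff_distrib mult_1_left)
    moreover have "\<not> f dvd \<Prod>R"
    proof
      assume "f dvd \<Prod>R"
      then obtain r where "r \<in> R" "f dvd r"
        using prime_elem_dvd_prod[OF prime R(1)] by blast
      with small[of r] show False by (auto simp: R_def)
    qed
    ultimately have "f dvd x ^ card R - 1" using prime prime_elem_dvd_multD by blast
    then show "f dvd x * (x ^ card R - 1)" by (rule dvd_mult)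
  qed
qed

definition roots_in :: "('f::field \<Rightarrow> 'k::field) \<Rightarrow> 'f poly \<Rightarrow> 'k set"
  where "roots_in \<iota> f = {a. poly (map_poly \<iota> f) a = 0}"

context
  fixes \<iota> :: "'f::{field,finite} \<Rightarrow> 'k::{field,finite}"
  assumes \<iota>: "field_hom \<iota>"
begin

interpretation field_hom \<iota> by (rule \<iota>)
interpretation map_poly: map_poly_inj_idom_hom \<iota> ..

text \<open>
  Write \<open>x ^ Q - x = f * h\<close> with \<open>Q = CARD('k)\<close>. All \<open>Q\<close> elements of the extension field are roots
  of the left-hand side, while \<open>f\<close> and \<open>h\<close> together have at most \<open>degree f + degree h = Q\<close> roots.
  So \<open>f\<close> has as many roots as its degree allows.
\<close>

lemma card_roots_in:
  assumes f: "irreducible f" and card: "CARD('k) = CARD('f) ^ degree f"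
  shows "card (roots_in \<iota> f) = degree f"
proof -
  let ?x = "[:0, 1:] :: 'f poly"
  define Q where "Q = CARD('k)"
  have Q: "Q > 1" unfolding Q_def by (rule card_field_gt_1)
  have "f dvd ?x ^ Q - ?x" using irreducible_dvd_X_power_card_diff_X[OF f] by (simp only: Q_def card)
  then obtain h where h: "?x ^ Q - ?x = f * h" by (rule dvdE)
  have xQ: "degree (?x ^ Q) = Q" by (simp add: degree_power_eq)
  then have deg: "degree (?x ^ Q - ?x) = Q" using Q
    using degree_add_eq_left[of "- ?x" "?x ^ Q"] by (simp only: degree_minus diff_conv_add_uminus) simp
  then have "f * h \<noteq> 0" using Q h by auto
  then have fh: "f \<noteq> 0" "h \<noteq> 0" by auto
  have sum: "degree f + degree h = Q" using deg fh by (simp only: h degree_mult_eq not_False_eq_True)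
  have bound: "card (roots_in \<iota> p) \<le> degree p" if "p \<noteq> 0" for p
    unfolding roots_in_def using card_poly_roots_bound[of "map_poly \<iota> p"] that by simp
  have "a \<in> roots_in \<iota> f \<union> roots_in \<iota> h" for a
  proof -
    have "poly (map_poly \<iota> (f * h)) a = poly (map_poly \<iota> (?x ^ Q - ?x)) a" by (simp only: h)
    also have "\<dots> = a ^ Q - a" by (simp add: hom_distribs)
    also have "\<dots> = 0" by (simp add: Q_def finite_field_power_card)
    finally show ?thesis by (simp add: roots_in_def hom_distribs)
  qed
  then have "UNIV \<subseteq> roots_in \<iota> f \<union> roots_in \<iota> h" by blast
  then have "Q \<le> card (roots_in \<iota> f \<union> roots_in \<iota> h)" unfolding Q_def by (intro card_mono) auto
  also have "\<dots> \<le> card (roots_in \<iota> f) + card (roots_in \<iota> h)" by (rule card_Un_le)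
  finally show ?thesis using bound[OF fh(1)] bound[OF fh(2)] sum by simp
qed

lemma map_poly_eq_prod_roots_in:
  assumes f: "irreducible f" "monic f" and card: "CARD('k) = CARD('f) ^ degree f"
  shows "map_poly \<iota> f = (\<Prod>a\<in>roots_in \<iota> f. [:- a, 1:])"
proof (rule poly_eqI_degree_lead_coeff[where n = "degree f" and A = "roots_in \<iota> f"])
  let ?p = "\<Prod>a\<in>roots_in \<iota> f. [:- a, 1:]"
  have deg: "degree ?p = degree f"
    using card_roots_in[OF f(1) card] by (simp add: degree_prod_eq_sum_degree)
  have "monic ?p" by (intro monic_prod) simp
  then show "coeff (map_poly \<iota> f) (degree f) = coeff ?p (degree f)" using f(2) by (simp add: deg)
  show "degree ?p \<le> degree f" by (simp add: deg)
  show "poly (map_poly \<iota> f) z = poly ?p z" if "z \<in> roots_in \<iota> f" for z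
    using that by (auto simp: roots_in_def poly_prod)
qed (simp_all add: card_roots_in[OF f(1) card])

lemma roots_in_disjoint:
  assumes "irreducible f" "monic f" "irreducible g" "monic g" "f \<noteq> g"
  shows "roots_in \<iota> f \<inter> roots_in \<iota> g = {}"
proof -
  have "\<not> f dvd g"
  proof
    assume "f dvd g"
    then have "g dvd f" using assms irreducibleD'[of g f] irreducible_not_unit by blast
    with \<open>f dvd g\<close> assms poly_dvd_antisym[of f g] show False by simp
  qed
  then obtain a b where ab: "a * f + b * g = 1"
    using irreducible_imp_coprime_poly[OF assms(1)] coprime_poly_bezout by blast
  have one: "poly (map_poly \<iota> (a * f + b * g)) z = 1" for z by (simp only: ab) simp
  have "poly (map_poly \<iota> f) z \<noteq> 0 \<or> poly (map_poly \<iota> g) z \<noteq> 0" for z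
    using one[of z] by (auto simp: hom_distribs)
  then show ?thesis by (auto simp: roots_in_def)
qed

section \<open>Primary cyclicity in terms of eigenspaces\<close>

text \<open>
  This identity is the bridge between the two scalar fields: kernels of polynomials over the base
  field are kernels of polynomials over the extension field, hence subspaces over it.
\<close>

lemma poly_act_base_scale:
  "poly_act (base_scale \<iota>) f Y v = poly_act (base_scale (\<lambda>x. x)) (map_poly \<iota> f) Y v"
  by (simp add: poly_act_def base_scale_def)

end

context invariant_subspace
begin

lemma primary_component_eq: "primary_component scale V Y f = kernel (f ^ dim V)"
  by (simp add: primary_component_def kernel_def act_power)

lemma invariant_subspace_kernel: "invariant_subspace scale Y (kernel p)"
  using subspace_kernel finite_kernel Y_in_kernel by unfold_locales auto

text \<open>
  On the \<open>f\<close>-primary component, \<open>f(Y)\<close> is nilpotent of this index; equivalently,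
  \<open>f ^ nilpotency_index f\<close> is the minimal polynomial there when \<open>f\<close> is monic and irreducible.
\<close>

definition nilpotency_index :: "'a poly \<Rightarrow> nat"
  where "nilpotency_index f = (LEAST e. kernel (f ^ e) = kernel (f ^ dim V))"

lemma kernel_nilpotency_index: "kernel (f ^ nilpotency_index f) = kernel (f ^ dim V)"
  unfolding nilpotency_index_def by (rule LeastI[of _ "dim V"]) (rule refl)

lemma nilpotency_index_le: "nilpotency_index f \<le> dim V"
  unfolding nilpotency_index_def by (rule Least_le) (rule refl)

lemma kernel_below_nilpotency_index:
  "e < nilpotency_index f \<Longrightarrow> kernel (f ^ e) \<noteq> kernel (f ^ dim V)"
  unfolding nilpotency_index_def by (rule not_less_Least)

lemma kernel_strict_below_nilpotency_index:
  assumes "e < nilpotency_index f"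
  shows "kernel (f ^ e) \<subset> kernel (f ^ Suc e)"
proof -
  have "kernel (f ^ e) \<noteq> kernel (f ^ Suc e)"
  proof
    assume "kernel (f ^ e) = kernel (f ^ Suc e)"
    then have "kernel (f ^ dim V) = kernel (f ^ e)"
      by (rule kernel_power_stable) (use assms nilpotency_index_le[of f] in simp)
    with kernel_below_nilpotency_index[OF assms] show False by simp
  qed
  moreover have "kernel (f ^ e) \<subseteq> kernel (f ^ Suc e)" by (rule kernel_power_mono) simp
  ultimately show ?thesis by blast
qed

text \<open>
  The annihilators of the primary component are the multiples of \<open>f ^ nilpotency_index f\<close>, so the
  least degree of an annihilator is \<open>nilpotency_index f * degree f\<close>.
\<close>

lemma primary_cyclic_iff_dim:
  assumes f: "irreducible f"
  shows "primary_cyclic scale V Y f \<longleftrightarrow> kernel (f ^ nilpotency_index f) \<noteq> {0} \<and>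
    dim (kernel (f ^ nilpotency_index f)) \<le> nilpotency_index f * degree f"
proof -
  define e where "e = nilpotency_index f"
  define W where "W = kernel (f ^ e)"
  have W: "primary_component scale V Y f = W"
    by (simp add: primary_component_eq W_def e_def kernel_nilpotency_index)
  interpret W: invariant_subspace scale Y W unfolding W_def by (rule invariant_subspace_kernel)
  have ann: "annihilates_on scale W Y (f ^ e)" by (simp add: annihilates_on_def W_def kernel_def)
  have minimal: "\<not> annihilates_on scale W Y (f ^ s)" if s: "s < e" for s
  proof
    assume "annihilates_on scale W Y (f ^ s)"
    then have "W \<subseteq> kernel (f ^ s)" by (auto simp: annihilates_on_def W_def kernel_def)
    moreover have "kernel (f ^ s) \<subseteq> W" unfolding W_def using s by (intro kernel_power_mono) simp
    ultimately have "kernel (f ^ s) = kernel (f ^ dim V)"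
      by (simp add: W_def e_def kernel_nilpotency_index)
    with kernel_below_nilpotency_index[of s f] s show False by (simp add: e_def)
  qed
  have f0: "f \<noteq> 0" using f by auto
  have deg: "degree (f ^ e) = e * degree f" by (simp add: degree_power_eq f0)
  have "(\<forall>r. r \<noteq> 0 \<and> annihilates_on scale W Y r \<longrightarrow> dim W \<le> degree r) \<longleftrightarrow> dim W \<le> e * degree f"
  proof
    assume "\<forall>r. r \<noteq> 0 \<and> annihilates_on scale W Y r \<longrightarrow> dim W \<le> degree r"
    with ann f0 have "dim W \<le> degree (f ^ e)" by simp
    then show "dim W \<le> e * degree f" by (simp only: deg)
  next
    assume le: "dim W \<le> e * degree f"
    show "\<forall>r. r \<noteq> 0 \<and> annihilates_on scale W Y r \<longrightarrow> dim W \<le> degree r"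
    proof (intro allI impI, elim conjE)
      fix r assume r: "r \<noteq> 0" "annihilates_on scale W Y r"
      have "f ^ e dvd r" by (rule W.annihilator_prime_power_dvd[OF f ann minimal r])
      then have "degree (f ^ e) \<le> degree r" using r(1) by (rule dvd_imp_degree_le)
      then show "dim W \<le> degree r" using le by (simp add: deg)
    qed
  qed
  then show ?thesis
    unfolding primary_cyclic_def W W.min_poly_eq_char_poly_iff by (simp only: W_def e_def)
qed

end

text \<open>
  A product of powers of \<open>q\<close> equals \<open>q\<close> precisely when one exponent is \<open>1\<close> and all the others
  vanish. At most one index can be the distinguished one, so the sum on the right is \<open>0\<close> or \<open>1\<close>.
\<close>

lemma of_bool_prod_eq_card_power:
  fixes d :: "'s \<Rightarrow> nat" and q :: nat
  assumes "finite R" "q > 1"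
  shows "of_bool ((\<Prod>a\<in>R. q ^ d a) = q) = (\<Sum>a\<in>R. \<Prod>b\<in>R. of_bool (q ^ d b = q ^ of_bool (b = a)) :: real)"
proof -
  have term_eq: "(\<Prod>b\<in>R. of_bool (q ^ d b = q ^ of_bool (b = a)) :: real)
      = of_bool (\<forall>b\<in>R. d b = of_bool (b = a))" for a
    using assms by (auto simp: power_inject_exp intro!: prod_zero)
  have "(\<Prod>a\<in>R. q ^ d a) = q \<longleftrightarrow> q ^ (\<Sum>a\<in>R. d a) = q ^ 1" by (simp add: power_sum)
  also have "\<dots> \<longleftrightarrow> (\<Sum>a\<in>R. d a) = 1" using assms(2) by (rule power_inject_exp)
  also have "\<dots> \<longleftrightarrow> (\<exists>a\<in>R. \<forall>b\<in>R. d b = of_bool (b = a))"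
    unfolding sum_eq_1_iff[OF assms(1)] by (auto simp: of_bool_def)
  finally have lhs: "(\<Prod>a\<in>R. q ^ d a) = q \<longleftrightarrow> (\<exists>a\<in>R. \<forall>b\<in>R. d b = of_bool (b = a))" .
  show ?thesis
  proof (cases "\<exists>a\<in>R. \<forall>b\<in>R. d b = of_bool (b = a)")
    case True
    then obtain a where a: "a \<in> R" "\<And>b. b \<in> R \<Longrightarrow> d b = of_bool (b = a)" by blast
    have "(\<forall>b\<in>R. d b = of_bool (b = a')) \<longleftrightarrow> a' = a" if "a' \<in> R" for a'
      using a that by auto
    then have "(\<Sum>a'\<in>R. of_bool (\<forall>b\<in>R. d b = of_bool (b = a')) :: real) = (\<Sum>a'\<in>R. of_bool (a' = a))"
      by (intro sum.cong) auto
    also have "\<dots> = 1" using a(1) assms(1) by (simp add: of_bool_def)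
    finally show ?thesis unfolding lhs term_eq using True by simp
  next
    case False
    have "(\<Sum>a\<in>R. of_bool (\<forall>b\<in>R. d b = of_bool (b = a)) :: real) = 0"
    proof (intro sum.neutral ballI)
      fix a assume "a \<in> R"
      with False have "\<not> (\<forall>b\<in>R. d b = of_bool (b = a))" by blast
      then show "(of_bool (\<forall>b\<in>R. d b = of_bool (b = a)) :: real) = 0"
        by (simp only: of_bool_eq_0_iff not_False_eq_True)
    qed
    with False show ?thesis unfolding lhs term_eq by (simp only: of_bool_eq(1))
  qed
qed

locale finite_field_invariant_subspace =
  invariant_subspace scale Y V + finite_field_vector_space scale
  for scale :: "'a::{field,finite} \<Rightarrow> 'b::ab_group_add \<Rightarrow> 'b" (infixr "\<star>" 75) and Y V
begin

text \<open>
  In contrast to \<open>card_kernel_power_le\<close>, a strict step of the chain of kernels gains at least a factor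
  \<open>CARD('a)\<close>, because the kernels are subspaces.
\<close>

lemma card_kernel_power_ge:
  assumes "\<And>j. j \<le> e \<Longrightarrow> kernel (p ^ j) \<subset> kernel (p ^ Suc j)"
  shows "CARD('a) ^ e * card (kernel p) \<le> card (kernel (p ^ Suc e))"
  using assms
proof (induction e)
  case (Suc e)
  have "CARD('a) * (CARD('a) ^ e * card (kernel p)) \<le> CARD('a) * card (kernel (p ^ Suc e))"
    using Suc by (intro mult_le_mono2) simp
  also have "\<dots> \<le> card (kernel (p ^ Suc (Suc e)))"
    by (intro card_subspace_psubset finite_kernel subspace_kernel Suc.prems) simp
  finally show ?case by simp
qed simp

lemma primary_cyclic_iff_card:
  assumes f: "irreducible f"
  shows "primary_cyclic scale V Y f \<longleftrightarrow> kernel (f ^ nilpotency_index f) \<noteq> {0} \<and>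
    card (kernel (f ^ nilpotency_index f)) \<le> (CARD('a) ^ degree f) ^ nilpotency_index f"
proof -
  define e where "e = nilpotency_index f"
  have "card (kernel (f ^ e)) \<le> (CARD('a) ^ degree f) ^ e \<longleftrightarrow>
      CARD('a) ^ dim (kernel (f ^ e)) \<le> CARD('a) ^ (e * degree f)"
    by (simp only: card_subspace[OF finite_kernel subspace_kernel] power_mult[symmetric] mult.commute)
  also have "\<dots> \<longleftrightarrow> dim (kernel (f ^ e)) \<le> e * degree f"
    using card_field_gt_1[where 'a = 'a] by (simp add: power_increasing_iff)
  finally show ?thesis unfolding primary_cyclic_iff_dim[OF f] e_def by simp
qed

end

lemma finite_row_space: "finite (row_space c :: (nat \<Rightarrow> 'k::{field,finite}) set)"
  and card_row_space: "card (row_space c :: (nat \<Rightarrow> 'k::{field,finite}) set) = CARD('k) ^ c"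
proof -
  let ?h = "\<lambda>v :: nat \<Rightarrow> 'k. restrict v {..<c}"
  have "inj_on ?h (row_space c)"
  proof (rule inj_onI, rule ext)
    fix v w :: "nat \<Rightarrow> 'k" and i assume vw: "v \<in> row_space c" "w \<in> row_space c" "?h v = ?h w"
    show "v i = w i"
    proof (cases "i < c")
      case True
      then show ?thesis using fun_cong[OF vw(3), of i] by simp
    qed (use vw in \<open>simp add: row_space_def\<close>)
  qed
  moreover have "?h ` row_space c = ({..<c} \<rightarrow>\<^sub>E UNIV)"
  proof (intro subset_antisym subsetI)
    fix g :: "nat \<Rightarrow> 'k" assume g: "g \<in> {..<c} \<rightarrow>\<^sub>E UNIV"
    show "g \<in> ?h ` row_space c"
    proof (rule image_eqI)
      let ?v = "\<lambda>i. if i < c then g i else 0"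
      show "g = ?h ?v" using g by (auto simp: fun_eq_iff PiE_def extensional_def)
      show "?v \<in> row_space c" by (simp add: row_space_def)
    qed
  qed (auto split: if_splits)
  ultimately have bij: "bij_betw ?h (row_space c) ({..<c} \<rightarrow>\<^sub>E UNIV)" by (simp add: bij_betw_def)
  then show "finite (row_space c :: (nat \<Rightarrow> 'k) set)"
    by (simp add: bij_betw_finite finite_PiE)
  show "card (row_space c :: (nat \<Rightarrow> 'k) set) = CARD('k) ^ c"
    using bij_betw_same_card[OF bij] by (simp add: card_PiE)
qed

lemma finite_field_invariant_subspace_row_space:
  fixes \<iota> :: "'f::{field,finite} \<Rightarrow> 'k::{field,finite}"
  assumes "field_hom \<iota>" "X \<in> carrier_mat c c"
  shows "finite_field_invariant_subspace (base_scale \<iota>) (row_act X) (row_space c)"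
proof -
  interpret endomorphism "base_scale \<iota>" "row_act X"
    using assms(1)
    by (intro endomorphism.intro endomorphism_axioms.intro vector_space_base_scale linear_row_act)
  show ?thesis
    by unfold_locales
      (simp_all add: subspace_row_space[OF assms(1)] finite_row_space row_act_in_row_space[OF assms(2)])
qed

lemma field_hom_ident: "field_hom (\<lambda>x :: 'k::field. x)"
  by unfold_locales auto

abbreviation row_scale :: "'k::field \<Rightarrow> (nat \<Rightarrow> 'k) \<Rightarrow> nat \<Rightarrow> 'k"
  where "row_scale \<equiv> base_scale (\<lambda>x. x)"

definition eigenspace :: "'k::field mat \<Rightarrow> 'k \<Rightarrow> (nat \<Rightarrow> 'k) set"
  where "eigenspace X a = {v \<in> row_space (dim_row X). row_act X v = row_scale a v}"

lemma subspace_eigenspace: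
  fixes X :: "'k::{field,finite} mat"
  assumes X: "X \<in> carrier_mat c c"
  shows "module.subspace row_scale (eigenspace X a)" "finite (eigenspace X a)"
proof -
  interpret finite_field_invariant_subspace row_scale "row_act X" "row_space c"
    using field_hom_ident X by (rule finite_field_invariant_subspace_row_space)
  have "kernel [:- a, 1:] = eigenspace X a"
    using X by (auto simp: kernel_def eigenspace_def Y.zero)
  with subspace_kernel[of "[:- a, 1:]"] finite_kernel[of "[:- a, 1:]"]
  show "subspace (eigenspace X a)" "finite (eigenspace X a)" by simp_all
qed

lemma card_eigenspace:
  fixes X :: "'k::{field,finite} mat"
  assumes X: "X \<in> carrier_mat c c"
  shows "\<exists>d\<le>c. card (eigenspace X a) = CARD('k) ^ d"
proof -
  interpret finite_field_invariant_subspace row_scale "row_act X" "row_space c"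
    using field_hom_ident X by (rule finite_field_invariant_subspace_row_space)
  have card: "card (eigenspace X a) = CARD('k) ^ dim (eigenspace X a)"
    using subspace_eigenspace[OF X] by (intro card_subspace)
  have "eigenspace X a \<subseteq> row_space c" using X by (auto simp: eigenspace_def)
  then have "card (eigenspace X a) \<le> CARD('k) ^ c"
    using card_mono[OF finite_row_space] card_row_space by metis
  then have "dim (eigenspace X a) \<le> c"
    using card_field_gt_1[where 'a = 'k] by (simp add: card power_increasing_iff)
  with card show ?thesis by blast
qed

text \<open>
  Let \<open>e\<close> be the nilpotency index and \<open>W = ker f(X)\<^sup>e\<close> the primary component. Over the base
  field, cyclicity means that \<open>W\<close> is nonzero and \<open>|W| \<le> Q\<^sup>e\<close>. The chain of kernels up to \<open>W\<close>
  consists of subspaces over the extension field and is strict, so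
  \<open>Q ^ (e - 1) * |ker f(X)| \<le> |W| \<le> |ker f(X)| ^ e\<close>. Hence cyclicity amounts to \<open>|ker f(X)| = Q\<close>.
  Finally \<open>f\<close> is a product of distinct linear factors over the extension field, and \<open>ker f(X)\<close> is
  the direct sum of the eigenspaces of its roots.
\<close>

lemma primary_cyclic_row_act_iff:
  fixes \<iota> :: "'f::{field,finite} \<Rightarrow> 'k::{field,finite}"
  assumes \<iota>: "field_hom \<iota>" and X: "X \<in> carrier_mat c c" and c: "c > 0"
    and f: "irreducible f" "monic f" and card: "CARD('k) = CARD('f) ^ degree f"
  shows "primary_cyclic (base_scale \<iota>) (row_space c) (row_act X) f \<longleftrightarrow>
    (\<Prod>a\<in>roots_in \<iota> f. card (eigenspace X a)) = CARD('k)"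
proof -
  interpret F: finite_field_invariant_subspace "base_scale \<iota>" "row_act X" "row_space c"
    using \<iota> X by (rule finite_field_invariant_subspace_row_space)
  interpret K: finite_field_invariant_subspace row_scale "row_act X" "row_space c"
    using field_hom_ident X by (rule finite_field_invariant_subspace_row_space)
  interpret \<iota>: map_poly_inj_idom_hom \<iota>
  proof -
    interpret field_hom \<iota> by (rule \<iota>)
    show "map_poly_inj_idom_hom \<iota>" ..
  qed
  define Q where "Q = CARD('k)"
  define g where "g = map_poly \<iota> f"
  define e where "e = F.nilpotency_index f"
  have Q: "Q > 1" unfolding Q_def by (rule card_field_gt_1)
  have kernel: "F.kernel (f ^ n) = K.kernel (g ^ n)" for n
    by (simp add: F.kernel_def K.kernel_def poly_act_base_scale[OF \<iota>] g_def \<iota>.hom_power)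
  have dim: "F.dim (row_space c) > 0"
  proof (rule ccontr)
    assume "\<not> F.dim (row_space c) > 0"
    then have "card (row_space c :: (nat \<Rightarrow> 'k) set) = 1"
      using F.card_subspace[OF F.finite_V F.subspace_V] by simp
    moreover have "Q ^ c > 1" using Q c by (intro one_less_power)
    ultimately show False by (simp only: card_row_space Q_def)
  qed
  have "K.kernel (g ^ 1) \<subseteq> K.kernel (g ^ F.dim (row_space c))"
    using dim by (intro K.kernel_power_mono) simp
  then have sub: "K.kernel g \<subseteq> K.kernel (g ^ e)"
    by (simp add: e_def kernel[symmetric] F.kernel_nilpotency_index)
  have "primary_cyclic (base_scale \<iota>) (row_space c) (row_act X) f \<longleftrightarrow>
      K.kernel (g ^ e) \<noteq> {0} \<and> card (K.kernel (g ^ e)) \<le> Q ^ e"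
    unfolding F.primary_cyclic_iff_card[OF f(1)] by (simp add: kernel e_def Q_def card)
  also have "\<dots> \<longleftrightarrow> card (K.kernel g) = Q"
  proof
    assume Qg: "card (K.kernel g) = Q"
    have "K.kernel (g ^ e) \<noteq> {0}"
    proof
      assume "K.kernel (g ^ e) = {0}"
      then have "card (K.kernel g) \<le> card {0 :: nat \<Rightarrow> 'k}" using sub by (intro card_mono) auto
      with Qg Q show False by simp
    qed
    with K.card_kernel_power_le[of g e] Qg
    show "K.kernel (g ^ e) \<noteq> {0} \<and> card (K.kernel (g ^ e)) \<le> Q ^ e" by simp
  next
    assume W: "K.kernel (g ^ e) \<noteq> {0} \<and> card (K.kernel (g ^ e)) \<le> Q ^ e"
    obtain e' where e': "e = Suc e'" using W by (cases e) auto
    have "Q ^ e' * card (K.kernel g) \<le> card (K.kernel (g ^ Suc e'))"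
      unfolding Q_def
    proof (rule K.card_kernel_power_ge)
      fix j assume "j \<le> e'"
      then have "F.kernel (f ^ j) \<subset> F.kernel (f ^ Suc j)"
        by (intro F.kernel_strict_below_nilpotency_index) (simp add: e' flip: e_def)
      then show "K.kernel (g ^ j) \<subset> K.kernel (g ^ Suc j)" by (simp only: kernel)
    qed
    also have "\<dots> \<le> Q ^ e' * Q" using W by (simp add: e' mult.commute)
    finally have "card (K.kernel g) \<le> Q" using Q by simp
    moreover have "Q \<le> card (K.kernel g)"
    proof -
      have "K.kernel g \<noteq> {0}"
      proof
        assume "K.kernel g = {0}"
        then have "card (K.kernel (g ^ e)) \<le> Suc 0" using K.card_kernel_power_le[of g e] by simp
        then have "\<forall>u\<in>K.kernel (g ^ e). \<forall>v\<in>K.kernel (g ^ e). u = v"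
          by (simp only: card_le_Suc0_iff_eq[OF K.finite_kernel])
        moreover have "0 \<in> K.kernel (g ^ e)" using K.subspace_kernel K.subspace_0 by blast
        ultimately have "K.kernel (g ^ e) = {0}" by blast
        with W show False by simp
      qed
      moreover have "0 \<in> K.kernel g" using K.subspace_kernel K.subspace_0 by blast
      ultimately have "{0} \<subset> K.kernel g" by blast
      from K.card_subspace_psubset[OF K.finite_kernel K.subspace_kernel K.subspace_single_0 this]
      show ?thesis by (simp add: Q_def)
    qed
    ultimately show "card (K.kernel g) = Q" by simp
  qed
  also have "card (K.kernel g) = (\<Prod>a\<in>roots_in \<iota> f. card (eigenspace X a))"
    unfolding g_def map_poly_eq_prod_roots_in[OF \<iota> f card]
    using X by (subst K.card_kernel_linear_factors) (simp_all add: eigenspace_def)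
  finally show ?thesis by (simp only: Q_def)
qed

text \<open>
  The events on the right prescribe the dimension \<open>1\<close> for the eigenspace of one root \<open>a\<close> and \<open>0\<close> for
  the others; this is the form in which the average over all matrices is computed.
\<close>

lemma of_bool_primary_cyclic_row_act:
  fixes \<iota> :: "'f::{field,finite} \<Rightarrow> 'k::{field,finite}"
  assumes "field_hom \<iota>" "X \<in> carrier_mat c c" "c > 0" "irreducible f" "monic f"
    and "CARD('k) = CARD('f) ^ degree f"
  shows "of_bool (primary_cyclic (base_scale \<iota>) (row_space c) (row_act X) f) =
    (\<Sum>a\<in>roots_in \<iota> f. \<Prod>b\<in>roots_in \<iota> f.
      of_bool (card (eigenspace X b) = CARD('k) ^ of_bool (b = a)) :: real)"
proof -
  obtain d where d: "\<And>a. card (eigenspace X a) = CARD('k) ^ d a"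
    using card_eigenspace[OF assms(2)] by metis
  show ?thesis
    unfolding primary_cyclic_row_act_iff[OF assms] d
    by (intro of_bool_prod_eq_card_power card_field_gt_1) simp
qed

section \<open>Inverting the q-factorial moments\<close>

text \<open>
  For \<open>x = Q\<^sup>d\<close> this is the number of linearly independent \<open>m\<close>-tuples in a \<open>d\<close>-dimensional space
  over a field with \<open>Q\<close> elements; in particular \<open>q_falling Q (Q ^ k) k\<close> is the order of the general
  linear group of rank \<open>k\<close>.
\<close>

definition q_falling :: "real \<Rightarrow> real \<Rightarrow> nat \<Rightarrow> real"
  where "q_falling Q x m = (\<Prod>i<m. x - Q ^ i)"

definition q_prod :: "real \<Rightarrow> nat \<Rightarrow> real"
  where "q_prod Q n = (\<Prod>i<n. Q ^ Suc i - 1)"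

text \<open>
  These are the coefficients of Gaussian inversion: the indicator of \<open>d = k\<close> is the combination of the
  numbers \<open>q_falling Q (Q ^ d) (k + j)\<close> with weights \<open>inv_coeff Q k j\<close>, as
  \<open>sum_inv_coeff_q_falling\<close> shows.
\<close>

definition inv_coeff :: "real \<Rightarrow> nat \<Rightarrow> nat \<Rightarrow> real"
  where "inv_coeff Q k j = (- 1) ^ j / (q_falling Q (Q ^ k) k * Q ^ (k * j) * q_prod Q j)"

lemma q_falling_Suc [simp]: "q_falling Q x (Suc m) = q_falling Q x m * (x - Q ^ m)"
  and q_falling_0 [simp]: "q_falling Q x 0 = 1"
  by (simp_all add: q_falling_def)

lemma q_prod_Suc [simp]: "q_prod Q (Suc m) = q_prod Q m * (Q * Q ^ m - 1)"
  and q_prod_0 [simp]: "q_prod Q 0 = 1"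
  by (simp_all add: q_prod_def)

text \<open>
  This is the limiting probability that the kernel of a random square matrix of growing size has
  dimension \<open>k\<close>: in the limit every moment becomes \<open>1\<close>, so only the weights remain.
\<close>

definition corank_limit :: "real \<Rightarrow> nat \<Rightarrow> real"
  where "corank_limit Q k = (\<Sum>j. inv_coeff Q k j)"

definition geometric_rate :: "real \<Rightarrow> (nat \<Rightarrow> real) \<Rightarrow> real \<Rightarrow> bool"
  where "geometric_rate Q f l \<longleftrightarrow> (\<exists>C. \<forall>n. \<bar>f n - l\<bar> \<le> C / Q ^ n)"

context
  fixes Q :: real
  assumes Q2: "Q \<ge> 2"
begin

lemma q_power_gt_1: "Q * Q ^ i > 1"
proof -
  have "1 < Q ^ Suc i" using Q2 by (intro one_less_power) auto
  then show ?thesis by simp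
qed

lemma q_prod_pos: "q_prod Q n > 0"
  using q_power_gt_1 by (simp add: q_prod_def prod_pos)

lemma q_falling_diag_pos: "q_falling Q (Q ^ k) k > 0"
  unfolding q_falling_def using Q2 by (intro prod_pos) (auto intro!: power_strict_increasing)

lemma q_falling_add:
  "q_falling Q x (k + j) = q_falling Q x k * Q ^ (k * j) * q_falling Q (x / Q ^ k) j"
proof (induction j)
  case (Suc j)
  have "x - Q ^ (k + j) = Q ^ k * (x / Q ^ k - Q ^ j)"
    using Q2 by (simp add: power_add right_diff_distrib)
  then show ?case using Suc by (simp add: power_add)
qed simp

lemma q_falling_eq_0: "d < k \<Longrightarrow> q_falling Q (Q ^ d) k = 0"
  by (auto simp: q_falling_def)

text \<open>
  The partial sums factor completely, so at \<open>x = Q\<^sup>i\<close> with \<open>1 \<le> i \<le> n\<close> they vanish and at \<open>x = 1\<close> they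
  are \<open>1\<close>. This makes the inversion below a finite computation.
\<close>

lemma sum_q_falling:
  "(\<Sum>j\<le>n. (- 1) ^ j / q_prod Q j * q_falling Q x j) = (\<Prod>i<n. (Q ^ Suc i - x) / (Q ^ Suc i - 1))"
proof (induction n)
  case (Suc n)
  have sgn: "(- 1) ^ Suc n * q_falling Q x (Suc n) = (1 - x) * (\<Prod>i<n. Q ^ Suc i - x)" for n
  proof (induction n)
    case (Suc n)
    have "(- 1) ^ Suc (Suc n) * q_falling Q x (Suc (Suc n))
        = ((- 1) ^ Suc n * q_falling Q x (Suc n)) * (Q ^ Suc n - x)"
      by (simp only: q_falling_Suc[of Q x "Suc n"] power_Suc[of "- 1" "Suc n"]) (simp add: algebra_simps)
    then show ?case unfolding Suc by simp
  qed simp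
  have "(- 1) ^ Suc n / q_prod Q (Suc n) * q_falling Q x (Suc n)
      = ((- 1) ^ Suc n * q_falling Q x (Suc n)) / q_prod Q (Suc n)" by simp
  also have "\<dots> = (1 - x) * (\<Prod>i<n. Q ^ Suc i - x) / (q_prod Q n * (Q ^ Suc n - 1))"
    unfolding sgn by simp
  also have "\<dots> = (\<Prod>i<n. (Q ^ Suc i - x) / (Q ^ Suc i - 1)) * ((1 - x) / (Q ^ Suc n - 1))"
    by (simp add: prod_dividef q_prod_def)
  finally have "(\<Sum>j\<le>Suc n. (- 1) ^ j / q_prod Q j * q_falling Q x j)
      = (\<Prod>i<n. (Q ^ Suc i - x) / (Q ^ Suc i - 1)) * (1 + (1 - x) / (Q ^ Suc n - 1))"
    using Suc by (simp only: sum.atMost_Suc) (simp add: distrib_left)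
  also have "1 + (1 - x) / (Q ^ Suc n - 1) = (Q ^ Suc n - x) / (Q ^ Suc n - 1)"
    using q_power_gt_1[of n] by (simp add: field_simps)
  finally show ?case by simp
qed simp

lemma sum_inv_coeff_q_falling:
  assumes "d \<le> n"
  shows "(\<Sum>j\<le>n. inv_coeff Q k j * q_falling Q (Q ^ d) (k + j)) = of_bool (d = k)"
proof -
  have "inv_coeff Q k j * q_falling Q (Q ^ d) (k + j)
      = q_falling Q (Q ^ d) k / q_falling Q (Q ^ k) k * ((- 1) ^ j / q_prod Q j * q_falling Q (Q ^ d / Q ^ k) j)" for j
    using Q2 by (simp add: inv_coeff_def q_falling_add)
  then have "(\<Sum>j\<le>n. inv_coeff Q k j * q_falling Q (Q ^ d) (k + j))
      = q_falling Q (Q ^ d) k / q_falling Q (Q ^ k) k * (\<Prod>i<n. (Q ^ Suc i - Q ^ d / Q ^ k) / (Q ^ Suc i - 1))"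
    by (simp only: sum_distrib_left[symmetric] sum_q_falling)
  also have "\<dots> = of_bool (d = k)"
  proof (cases d k rule: linorder_cases)
    case less
    then show ?thesis by (simp add: q_falling_eq_0)
  next
    case equal
    have "(Q ^ Suc i - Q ^ k / Q ^ k) / (Q ^ Suc i - 1) = 1" for i
      using Q2 q_power_gt_1[of i] by simp
    with equal q_falling_diag_pos[of k] show ?thesis by simp
  next
    case greater
    have "Q ^ Suc (d - Suc k) - Q ^ d / Q ^ k = 0"
      using greater Q2 by (simp add: power_diff Suc_diff_Suc flip: power_Suc)
    then have "(\<Prod>i<n. (Q ^ Suc i - Q ^ d / Q ^ k) / (Q ^ Suc i - 1)) = 0"
      using greater assms by (intro prod_zero bexI[of _ "d - Suc k"]) auto
    with greater show ?thesis by simp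
  qed
  finally show ?thesis .
qed

lemma abs_inv_coeff: "\<bar>inv_coeff Q k j\<bar> = 1 / (q_falling Q (Q ^ k) k * Q ^ (k * j) * q_prod Q j)"
  using Q2 q_prod_pos[of j] q_falling_diag_pos[of k] by (simp add: inv_coeff_def abs_mult)

text \<open>
  The weights decay at least like \<open>Q ^ (- j\<^sup>2 / 2)\<close>, so they remain summable against the factor \<open>Q ^ (k + j)\<close>
  by which the moment of order \<open>k + j\<close> may deviate from its limit, up to the factor \<open>Q ^ (- c)\<close>.
\<close>

lemma summable_inv_coeff_weighted: "summable (\<lambda>j. \<bar>inv_coeff Q k j\<bar> * Q ^ (k + j))"
proof (rule summable_ratio_test[of "1 / 2" 2])
  fix n :: nat assume n: "n \<ge> 2"
  have "Q ^ 3 \<le> Q ^ Suc n" using n Q2 by (intro power_increasing) auto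
  moreover have "4 * Q \<le> Q ^ 3"
  proof -
    have "2 * 2 \<le> Q * Q" using Q2 by (intro mult_mono) auto
    then show ?thesis using Q2 by (simp add: power3_eq_cube)
  qed
  ultimately have "Q / (Q ^ Suc n - 1) \<le> 1 / 2" using Q2 by (simp add: field_simps)
  moreover have "1 / Q ^ k \<le> 1" using Q2 by simp
  ultimately have r: "1 / Q ^ k * (Q / (Q ^ Suc n - 1)) \<le> 1 * (1 / 2)"
    using Q2 q_power_gt_1[of n] by (intro mult_mono) auto
  have "\<bar>inv_coeff Q k (Suc n)\<bar> * Q ^ (k + Suc n)
      = \<bar>inv_coeff Q k n\<bar> * Q ^ (k + n) * (1 / Q ^ k * (Q / (Q ^ Suc n - 1)))"
    by (simp add: abs_inv_coeff power_add)
  also have "\<dots> \<le> \<bar>inv_coeff Q k n\<bar> * Q ^ (k + n) * (1 * (1 / 2))"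
    using Q2 by (intro mult_left_mono r) auto
  finally show "norm (\<bar>inv_coeff Q k (Suc n)\<bar> * Q ^ (k + Suc n)) \<le> 1 / 2 * norm (\<bar>inv_coeff Q k n\<bar> * Q ^ (k + n))"
    using Q2 by simp
qed simp

lemma summable_abs_inv_coeff: "summable (\<lambda>j. \<bar>inv_coeff Q k j\<bar>)"
proof (rule summable_comparison_test[OF _ summable_inv_coeff_weighted[of k]], intro exI allI impI)
  fix n
  have "\<bar>inv_coeff Q k n\<bar> * 1 \<le> \<bar>inv_coeff Q k n\<bar> * Q ^ (k + n)"
    using Q2 by (intro mult_left_mono) auto
  then show "norm \<bar>inv_coeff Q k n\<bar> \<le> \<bar>inv_coeff Q k n\<bar> * Q ^ (k + n)" by simp
qed

lemma summable_inv_coeff: "summable (inv_coeff Q k)"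
  using summable_abs_inv_coeff by (rule summable_rabs_cancel)

text \<open>
  Euler's identity. The functional equation lets one split off one factor of \<open>omega 1 Q\<close> at a time,
  and \<open>E (1 / Q\<^sup>n)\<close> tends to \<open>E 0 = 1\<close>.
\<close>

lemma euler_product:
  defines "E \<equiv> \<lambda>u. \<Sum>j. inv_coeff Q 0 j * u ^ j"
  shows "0 \<le> u \<Longrightarrow> u \<le> 1 \<Longrightarrow> E u = (1 - u / Q) * E (u / Q)" and "E 1 = omega 1 Q"
proof -
  let ?a = "inv_coeff Q 0"
  have sm: "summable (\<lambda>j. ?a j * v ^ j)" if "\<bar>v\<bar> \<le> 1" for v
  proof (rule summable_comparison_test[OF _ summable_abs_inv_coeff[of 0]], intro exI allI impI)
    fix n
    have "\<bar>v\<bar> ^ n \<le> 1" using that by (simp add: power_le_one)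
    then have "\<bar>?a n\<bar> * \<bar>v\<bar> ^ n \<le> \<bar>?a n\<bar> * 1" by (intro mult_left_mono) auto
    then show "norm (?a n * v ^ n) \<le> \<bar>?a n\<bar>" by (simp add: abs_mult power_abs)
  qed
  show fe: "E u = (1 - u / Q) * E (u / Q)" if u: "0 \<le> u" "u \<le> 1" for u
  proof -
    have v: "\<bar>u / Q\<bar> \<le> 1" using u Q2 by (simp add: field_simps)
    have a0: "?a 0 = 1" by (simp add: inv_coeff_def)
    have step: "?a (Suc j) * u ^ Suc j - ?a (Suc j) * (u / Q) ^ Suc j = - (u / Q) * (?a j * (u / Q) ^ j)" for j
    proof -
      have "?a (Suc j) = - ?a j / (Q * Q ^ j - 1)"
        by (simp add: inv_coeff_def)
      moreover have "u ^ Suc j - (u / Q) ^ Suc j = (u / Q) * (u / Q) ^ j * (Q * Q ^ j - 1)"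
        using Q2 by (simp add: power_divide field_simps)
      ultimately have "?a (Suc j) * (u ^ Suc j - (u / Q) ^ Suc j) = - (u / Q) * (?a j * (u / Q) ^ j)"
        using q_power_gt_1[of j] by simp
      then show ?thesis by (simp add: right_diff_distrib)
    qed
    have "E u - E (u / Q) = (\<Sum>j. ?a j * u ^ j - ?a j * (u / Q) ^ j)"
      unfolding E_def using sm[of u] sm[OF v] u by (intro suminf_diff) auto
    also have "\<dots> = (\<Sum>j. ?a (Suc j) * u ^ Suc j - ?a (Suc j) * (u / Q) ^ Suc j)"
      using sm[of u] sm[OF v] u
      by (subst suminf_split_head) (auto intro!: summable_diff)
    also have "\<dots> = - (u / Q) * E (u / Q)"
      unfolding step E_def by (rule suminf_mult[OF sm[OF v]])
    finally show ?thesis by (simp add: algebra_simps)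
  qed
  have E1: "E 1 = (\<Prod>i<n. 1 - 1 / Q ^ Suc i) * E (1 / Q ^ n)" for n
  proof (induction n)
    case (Suc n)
    have "E (1 / Q ^ n) = (1 - 1 / Q ^ n / Q) * E (1 / Q ^ n / Q)"
      by (rule fe) (use Q2 in auto)
    then show ?case using Suc by (simp add: mult.commute[of Q])
  qed simp
  have "(\<lambda>n. 1 / Q ^ n) \<longlonglongrightarrow> 0"
    using Q2 LIMSEQ_realpow_zero[of "1 / Q"] by (simp add: power_one_over)
  moreover have "isCont E 0"
    unfolding E_def by (rule isCont_powser[of _ 1]) (use sm[of 1] in auto)
  ultimately have "(\<lambda>n. E (1 / Q ^ n)) \<longlonglongrightarrow> E 0" by (rule isCont_tendsto_compose[rotated])
  moreover have "E 0 = 1" unfolding E_def by (subst powser_zero) (simp add: inv_coeff_def)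
  ultimately have lim: "(\<lambda>n. E (1 / Q ^ n)) \<longlonglongrightarrow> 1" by simp
  (* An infinite product is only determined by the limit of its partial products if that limit
     is nonzero. *)
  have "E 1 \<noteq> 0"
  proof
    assume "E 1 = 0"
    moreover have "Q * Q ^ i \<noteq> 1" for i
      using q_power_gt_1[of i] by auto
    then have "(\<Prod>i<n. 1 - 1 / Q ^ Suc i) \<noteq> 0" for n
      using Q2 by auto
    ultimately have "E (1 / Q ^ n) = 0" for n using E1[of n] by auto
    with lim show False by (simp add: LIMSEQ_const_iff)
  qed
  have ne: "E (1 / Q ^ n) \<noteq> 0" for n using E1[of n] \<open>E 1 \<noteq> 0\<close> by auto
  have "(\<lambda>n. E 1 / E (1 / Q ^ n)) \<longlonglongrightarrow> E 1 / 1" by (intro tendsto_intros lim) simp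
  moreover have "E 1 / E (1 / Q ^ n) = (\<Prod>i<n. 1 - 1 / Q ^ Suc i)" for n
    using E1[of n] ne[of n] by (simp add: field_simps)
  ultimately have "(\<lambda>n. \<Prod>i<n. 1 - 1 / Q ^ Suc i) \<longlonglongrightarrow> E 1" by simp
  from prodinf_eq_prod_lim'[OF this \<open>E 1 \<noteq> 0\<close>] show "E 1 = omega 1 Q" by (simp add: omega_def)
qed

lemma corank_limit_0: "corank_limit Q 0 = omega 1 Q"
  using euler_product(2) by (simp add: corank_limit_def)

lemma corank_limit_1: "corank_limit Q 1 = 1 / Q / (1 - 1 / Q)\<^sup>2 * omega 1 Q"
proof -
  have s: "summable (\<lambda>j. inv_coeff Q 1 j)" using summable_inv_coeff by simp
  have e: "inv_coeff Q 0 j * (1 / Q) ^ j = (Q - 1) * inv_coeff Q 1 j" for j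
    using Q2 by (simp add: inv_coeff_def power_one_over)
  have "omega 1 Q = (1 - 1 / Q) * (\<Sum>j. inv_coeff Q 0 j * (1 / Q) ^ j)"
    using euler_product(1)[of 1] euler_product(2) by simp
  also have "\<dots> = (1 - 1 / Q) * ((Q - 1) * corank_limit Q 1)"
    unfolding e corank_limit_def by (simp only: suminf_mult[OF s])
  also have "(1 - 1 / Q) * ((Q - 1) * corank_limit Q 1) = Q * (1 - 1 / Q)\<^sup>2 * corank_limit Q 1"
    using Q2 by (simp add: power2_eq_square field_simps)
  finally show ?thesis using Q2 by (simp add: field_simps)
qed

section \<open>Convergence at a geometric rate\<close>

lemma geometric_rateI: "(\<And>n. \<bar>f n - l\<bar> \<le> C / Q ^ n) \<Longrightarrow> geometric_rate Q f l"
  by (auto simp: geometric_rate_def)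

lemma geometric_rate_tendsto:
  assumes "geometric_rate Q f l"
  shows "f \<longlonglongrightarrow> l"
proof -
  obtain C where C: "\<And>n. \<bar>f n - l\<bar> \<le> C / Q ^ n" using assms by (auto simp: geometric_rate_def)
  have "(\<lambda>n. C * (1 / Q) ^ n) \<longlonglongrightarrow> 0"
    using Q2 LIMSEQ_realpow_zero[of "1 / Q"] by (auto intro: tendsto_mult_right_zero)
  then have "(\<lambda>n. f n - l) \<longlonglongrightarrow> 0"
    by (rule Lim_null_comparison[rotated]) (use C in \<open>auto simp: power_one_over\<close>)
  then show ?thesis by (simp add: LIM_zero_iff)
qed

lemma geometric_rate_const: "geometric_rate Q (\<lambda>_. l) l"
  by (rule geometric_rateI[of _ _ 0]) simp

lemma geometric_rate_diff:
  assumes "geometric_rate Q f l" "geometric_rate Q g m"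
  shows "geometric_rate Q (\<lambda>n. f n - g n) (l - m)"
proof -
  obtain C D where C: "\<And>n. \<bar>f n - l\<bar> \<le> C / Q ^ n" and D: "\<And>n. \<bar>g n - m\<bar> \<le> D / Q ^ n"
    using assms by (auto simp: geometric_rate_def)
  show ?thesis
  proof (rule geometric_rateI)
    fix n show "\<bar>f n - g n - (l - m)\<bar> \<le> (C + D) / Q ^ n"
      using C[of n] D[of n] by (simp add: add_divide_distrib)
  qed
qed

lemma geometric_rate_add:
  assumes "geometric_rate Q f l" "geometric_rate Q g m"
  shows "geometric_rate Q (\<lambda>n. f n + g n) (l + m)"
proof -
  have "geometric_rate Q (\<lambda>n. f n - (0 - g n)) (l - (0 - m))"
    by (intro geometric_rate_diff geometric_rate_const assms)
  then show ?thesis by simp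
qed

lemma geometric_rate_sum:
  assumes "\<And>i. i \<in> I \<Longrightarrow> geometric_rate Q (f i) (l i)"
  shows "geometric_rate Q (\<lambda>n. \<Sum>i\<in>I. f i n) (\<Sum>i\<in>I. l i)"
  using assms
  by (induction I rule: infinite_finite_induct) (auto intro!: geometric_rate_const geometric_rate_add)

lemma geometric_rate_mult:
  assumes "geometric_rate Q f l" "geometric_rate Q g m"
  shows "geometric_rate Q (\<lambda>n. f n * g n) (l * m)"
proof -
  obtain C D where C: "\<And>n. \<bar>f n - l\<bar> \<le> C / Q ^ n" and D: "\<And>n. \<bar>g n - m\<bar> \<le> D / Q ^ n"
    using assms by (auto simp: geometric_rate_def)
  show ?thesis
  proof (rule geometric_rateI)
    fix n
    have Qn: "Q ^ n \<ge> 1" using Q2 by simp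
    have D0: "D \<ge> 0"
    proof (rule ccontr)
      assume "\<not> D \<ge> 0"
      then have "D / Q ^ n < 0" using Qn by (intro divide_neg_pos) auto
      then show False using D[of n] by simp
    qed
    have "D / Q ^ n \<le> D" using D0 Qn by (simp add: divide_le_eq mult_le_cancel_left1)
    then have g: "\<bar>g n\<bar> \<le> \<bar>m\<bar> + D" using D[of n] by linarith
    have "f n * g n - l * m = (f n - l) * g n + l * (g n - m)" by (simp add: algebra_simps)
    then have "\<bar>f n * g n - l * m\<bar> \<le> \<bar>f n - l\<bar> * \<bar>g n\<bar> + \<bar>l\<bar> * \<bar>g n - m\<bar>"
      by (metis abs_mult abs_triangle_ineq)
    also have "\<dots> \<le> C / Q ^ n * (\<bar>m\<bar> + D) + \<bar>l\<bar> * (D / Q ^ n)"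
      using C[of n] D[of n] g by (intro add_mono mult_mono) auto
    also have "\<dots> = (C * (\<bar>m\<bar> + D) + \<bar>l\<bar> * D) / Q ^ n" by (simp add: add_divide_distrib)
    finally show "\<bar>f n * g n - l * m\<bar> \<le> (C * (\<bar>m\<bar> + D) + \<bar>l\<bar> * D) / Q ^ n" .
  qed
qed

lemma geometric_rate_prod:
  assumes "\<And>i. i \<in> I \<Longrightarrow> geometric_rate Q (f i) (l i)"
  shows "geometric_rate Q (\<lambda>n. \<Prod>i\<in>I. f i n) (\<Prod>i\<in>I. l i)"
  using assms
  by (induction I rule: infinite_finite_induct) (auto intro!: geometric_rate_const geometric_rate_mult)

lemma geometric_rate_inv_coeff: "geometric_rate Q (\<lambda>n. \<Sum>j\<le>n. inv_coeff Q k j) (corank_limit Q k)"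
proof (rule geometric_rateI)
  fix n
  let ?a = "inv_coeff Q k" and ?w = "\<lambda>j. \<bar>inv_coeff Q k j\<bar> * Q ^ (k + j)"
  have w0: "?w j \<ge> 0" for j using Q2 by simp
  have sa: "summable (\<lambda>j. \<bar>?a (j + Suc n)\<bar>)" and sw: "summable (\<lambda>j. ?w (j + Suc n))"
    using summable_ignore_initial_segment[OF summable_abs_inv_coeff, of k "Suc n"]
      summable_ignore_initial_segment[OF summable_inv_coeff_weighted, of k "Suc n"] by simp_all
  have "corank_limit Q k - (\<Sum>j\<le>n. ?a j) = (\<Sum>j. ?a (j + Suc n))"
    using suminf_minus_initial_segment[OF summable_inv_coeff, of k "Suc n"]
    by (simp add: corank_limit_def lessThan_Suc_atMost)
  then have "\<bar>(\<Sum>j\<le>n. ?a j) - corank_limit Q k\<bar> = \<bar>\<Sum>j. ?a (j + Suc n)\<bar>" by linarith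
  also have "\<dots> \<le> (\<Sum>j. \<bar>?a (j + Suc n)\<bar>)" by (rule summable_rabs[OF sa])
  also have "\<dots> \<le> (\<Sum>j. ?w (j + Suc n) / Q ^ n)"
  proof (rule suminf_le[OF _ sa summable_divide[OF sw]])
    fix j
    have "\<bar>?a (j + Suc n)\<bar> * Q ^ n \<le> ?w (j + Suc n)"
      using Q2 by (intro mult_left_mono power_increasing) auto
    then show "\<bar>?a (j + Suc n)\<bar> \<le> ?w (j + Suc n) / Q ^ n" using Q2 by (simp add: pos_le_divide_eq)
  qed
  also have "\<dots> = (\<Sum>j. ?w (j + Suc n)) / Q ^ n" by (rule suminf_divide[OF sw])
  also have "\<dots> \<le> (\<Sum>j. ?w j) / Q ^ n"
  proof (rule divide_right_mono)
    have "(\<Sum>j. ?w (j + Suc n)) = (\<Sum>j. ?w j) - (\<Sum>j<Suc n. ?w j)"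
      by (rule suminf_minus_initial_segment[OF summable_inv_coeff_weighted])
    moreover have "(\<Sum>j<Suc n. ?w j) \<ge> 0" by (intro sum_nonneg w0)
    ultimately show "(\<Sum>j. ?w (j + Suc n)) \<le> (\<Sum>j. ?w j)" by linarith
  qed (use Q2 in simp)
  finally show "\<bar>(\<Sum>j\<le>n. ?a j) - corank_limit Q k\<bar> \<le> (\<Sum>j. ?w j) / Q ^ n" .
qed

text \<open>
  For \<open>m \<le> n\<close> the factors lie in \<open>[0, 1]\<close> and the deficits \<open>Q\<^sup>i / Q\<^sup>n\<close> add up to at most
  \<open>(Q\<^sup>m - 1) / Q\<^sup>n\<close>; for \<open>m > n\<close> the product vanishes, but then the bound exceeds \<open>1\<close>.
\<close>

lemma moment_close_to_1: "\<bar>(\<Prod>i<m. 1 - Q ^ i / Q ^ n) - 1\<bar> \<le> Q ^ m / Q ^ n"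
proof (cases "m \<le> n")
  case True
  let ?P = "\<lambda>m. \<Prod>i<m. 1 - Q ^ i / Q ^ n"
  have "0 \<le> ?P m \<and> ?P m \<le> 1 \<and> 1 - ?P m \<le> (Q ^ m - 1) / Q ^ n"
    using True
  proof (induction m)
    case (Suc m)
    define t where "t = Q ^ m / Q ^ n"
    have IH: "0 \<le> ?P m" "?P m \<le> 1" "1 - ?P m \<le> (Q ^ m - 1) / Q ^ n" using Suc by auto
    have t: "0 \<le> t" "t \<le> 1" using Q2 Suc.prems by (auto simp: t_def divide_le_eq intro!: power_increasing)
    have eq: "?P (Suc m) = ?P m * (1 - t)" by (simp add: t_def)
    have "?P m * (1 - t) \<le> 1 * 1" using t IH by (intro mult_mono) auto
    moreover have "?P m * t \<le> 1 * t" using t IH by (intro mult_right_mono) auto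
    moreover have "(Q ^ m - 1) / Q ^ n + t \<le> (Q ^ Suc m - 1) / Q ^ n"
    proof -
      have "2 * Q ^ m \<le> Q * Q ^ m" using Q2 by (intro mult_right_mono) auto
      then have "(Q ^ m - 1 + Q ^ m) / Q ^ n \<le> (Q ^ Suc m - 1) / Q ^ n"
        using Q2 by (intro divide_right_mono) auto
      then show ?thesis unfolding t_def add_divide_distrib[symmetric] .
    qed
    moreover have "0 \<le> ?P m * (1 - t)" using t IH by simp
    ultimately show ?case unfolding eq using IH by (simp add: right_diff_distrib)
  qed simp
  moreover have "(Q ^ m - 1) / Q ^ n \<le> Q ^ m / Q ^ n" using Q2 by (intro divide_right_mono) auto
  ultimately show ?thesis by linarith
next
  case False
  then have "(\<Prod>i<m. 1 - Q ^ i / Q ^ n) = 0"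
    using Q2 by (intro prod_zero bexI[of _ n]) auto
  moreover have "1 \<le> Q ^ m / Q ^ n" using False Q2 by (simp add: pos_le_divide_eq power_increasing)
  ultimately show ?thesis by (simp only:)
qed

text \<open>
  For a set \<open>S\<close> of field elements, the sum is the joint probability of \<open>d a = k a\<close> for all
  \<open>a \<in> S\<close>, where \<open>d a\<close> is the dimension of the eigenspace for \<open>a\<close>, obtained by inverting the
  joint moments. Since these depend only on the total order of the moment and tend to
  \<open>1\<close>, the variables \<open>d a\<close> become independent in the limit.
\<close>

lemma geometric_rate_inverted_moments:
  fixes k :: "'s \<Rightarrow> nat"
  assumes "finite S"
  shows "geometric_rate Q (\<lambda>n. \<Sum>j\<in>S \<rightarrow>\<^sub>E {..n}. (\<Prod>a\<in>S. inv_coeff Q (k a) (j a)) *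
            (\<Prod>i<(\<Sum>a\<in>S. k a + j a). 1 - Q ^ i / Q ^ n))
          (\<Prod>a\<in>S. corank_limit Q (k a))"
proof -
  let ?v = "\<lambda>j. \<Prod>a\<in>S. inv_coeff Q (k a) (j a)" and ?m = "\<lambda>j. \<Sum>a\<in>S. k a + j a"
  define B where "B a = (\<Sum>j. \<bar>inv_coeff Q (k a) j\<bar> * Q ^ (k a + j))" for a
  have "geometric_rate Q (\<lambda>n. \<Sum>j\<in>S \<rightarrow>\<^sub>E {..n}. ?v j * ((\<Prod>i<?m j. 1 - Q ^ i / Q ^ n) - 1)) 0"
  proof (rule geometric_rateI)
    fix n
    have "\<bar>\<Sum>j\<in>S \<rightarrow>\<^sub>E {..n}. ?v j * ((\<Prod>i<?m j. 1 - Q ^ i / Q ^ n) - 1)\<bar>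
        \<le> (\<Sum>j\<in>S \<rightarrow>\<^sub>E {..n}. \<bar>?v j\<bar> * (Q ^ ?m j / Q ^ n))"
      by (rule order_trans[OF sum_abs], rule sum_mono)
        (auto simp: abs_mult simp del: times_divide_eq_right intro!: mult_left_mono moment_close_to_1)
    also have "\<dots> = (\<Sum>j\<in>S \<rightarrow>\<^sub>E {..n}. \<Prod>a\<in>S. \<bar>inv_coeff Q (k a) (j a)\<bar> * Q ^ (k a + j a)) / Q ^ n"
      by (simp add: sum_divide_distrib abs_prod prod.distrib power_sum)
    also have "\<dots> = (\<Prod>a\<in>S. \<Sum>j\<le>n. \<bar>inv_coeff Q (k a) j\<bar> * Q ^ (k a + j)) / Q ^ n"
      using assms by (subst prod_sum_PiE) auto
    also have "\<dots> \<le> (\<Prod>a\<in>S. B a) / Q ^ n"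
      unfolding B_def using Q2
      by (intro divide_right_mono prod_mono conjI sum_nonneg sum_le_suminf summable_inv_coeff_weighted) auto
    finally show "\<bar>(\<Sum>j\<in>S \<rightarrow>\<^sub>E {..n}. ?v j * ((\<Prod>i<?m j. 1 - Q ^ i / Q ^ n) - 1)) - 0\<bar> \<le> (\<Prod>a\<in>S. B a) / Q ^ n"
      by simp
  qed
  moreover have "geometric_rate Q (\<lambda>n. \<Sum>j\<in>S \<rightarrow>\<^sub>E {..n}. ?v j) (\<Prod>a\<in>S. corank_limit Q (k a))"
  proof -
    have "geometric_rate Q (\<lambda>n. \<Prod>a\<in>S. \<Sum>j\<le>n. inv_coeff Q (k a) j) (\<Prod>a\<in>S. corank_limit Q (k a))"
      by (intro geometric_rate_prod geometric_rate_inv_coeff)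
    then show ?thesis using assms by (simp add: prod_sum_PiE)
  qed
  ultimately have "geometric_rate Q (\<lambda>n. (\<Sum>j\<in>S \<rightarrow>\<^sub>E {..n}. ?v j * ((\<Prod>i<?m j. 1 - Q ^ i / Q ^ n) - 1))
      + (\<Sum>j\<in>S \<rightarrow>\<^sub>E {..n}. ?v j)) (0 + (\<Prod>a\<in>S. corank_limit Q (k a)))"
    by (rule geometric_rate_add)
  then show ?thesis by (simp add: sum.distrib[symmetric] right_diff_distrib)
qed

end

section \<open>Joint moments of the eigenspace dimensions\<close>

text \<open>
  Eigenvectors for different eigenvalues do not mix: applying \<open>Y - a\<close> to a combination of independent
  eigenvectors multiplies the coefficient of \<open>v\<close> by \<open>l v - a\<close>.
\<close>

lemma (in endomorphism) span_eigenvectors_Int_eigenspace: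
  assumes B: "finite B" "independent B" and l: "\<And>v. v \<in> B \<Longrightarrow> Y v = l v \<star> v"
    and u: "u \<in> span B" "Y u = a \<star> u"
  shows "u \<in> span {v \<in> B. l v = a}"
proof -
  obtain c where c: "u = (\<Sum>v\<in>B. c v \<star> v)" using u(1) by (auto simp: span_finite[OF B(1)])
  have "(\<Sum>v\<in>B. (c v * (l v - a)) \<star> v) = (\<Sum>v\<in>B. Y (c v \<star> v) - a \<star> c v \<star> v)"
    by (intro sum.cong refl) (simp add: Y.scale l scale_left_diff_distrib right_diff_distrib mult.commute)
  also have "\<dots> = 0" using u(2) by (simp add: sum_subtractf c Y.sum scale_sum_right)
  finally have "c v * (l v - a) = 0" if "v \<in> B" for v
    using independentD[OF B(2,1) order_refl, of "\<lambda>v. c v * (l v - a)"] that by blast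
  then have "c v = 0" if "v \<in> B" "l v \<noteq> a" for v using that by auto
  then have "u = (\<Sum>v\<in>{v \<in> B. l v = a}. c v \<star> v)"
    unfolding c using B(1) by (intro sum.mono_neutral_right) auto
  also have "\<dots> \<in> span {v \<in> B. l v = a}" by (intro span_sum span_scale span_base)
  finally show ?thesis .
qed

lemma finite_field_vector_space_row_scale:
  "finite_field_vector_space (row_scale :: 'k::{field,finite} \<Rightarrow> (nat \<Rightarrow> 'k) \<Rightarrow> nat \<Rightarrow> 'k)"
  unfolding finite_field_vector_space_def by (rule vector_space_base_scale[OF field_hom_ident])

interpretation row: finite_field_vector_space
  "row_scale :: 'k::{field,finite} \<Rightarrow> (nat \<Rightarrow> 'k) \<Rightarrow> nat \<Rightarrow> 'k"
  by (rule finite_field_vector_space_row_scale)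

lemma finite_carrier_mat: "finite (carrier_mat m n :: 'k::finite mat set)"
  and card_carrier_mat: "card (carrier_mat m n :: 'k::finite mat set) = CARD('k) ^ (m * n)"
proof -
  let ?I = "{..<m} \<times> {..<n}"
  let ?h = "\<lambda>X :: 'k mat. restrict (($$) X) ?I"
  have bij: "bij_betw ?h (carrier_mat m n) (?I \<rightarrow>\<^sub>E UNIV)"
  proof (rule bij_betw_byWitness[of _ "\<lambda>g. mat m n g"])
    show "\<forall>X\<in>carrier_mat m n. mat m n (?h X) = X" by (auto intro!: eq_matI)
    show "\<forall>g\<in>?I \<rightarrow>\<^sub>E UNIV. ?h (mat m n g) = g" by (auto simp: fun_eq_iff PiE_def extensional_def)
  qed (auto split: if_splits)
  from bij_betw_finite[OF bij] show "finite (carrier_mat m n :: 'k mat set)"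
    by (simp add: finite_PiE)
  from bij_betw_same_card[OF bij] show "card (carrier_mat m n :: 'k mat set) = CARD('k) ^ (m * n)"
    by (simp add: card_PiE card_cartesian_product)
qed

lemma row_act_unit:
  assumes "X \<in> carrier_mat c c" "i < c" "j < c"
  shows "row_act X (\<lambda>l. of_bool (l = i)) j = X $$ (i, j)"
  using assms by (simp add: row_act_def of_bool_def if_distrib[of "\<lambda>x. x * _"] cong: if_cong)

lemma row_act_eqI:
  fixes X X' :: "'k::{field,finite} mat"
  assumes X: "X \<in> carrier_mat c c" and X': "X' \<in> carrier_mat c c"
    and B: "row.span B = row_space c" and eq: "\<And>v. v \<in> B \<Longrightarrow> row_act X v = row_act X' v"
  shows "X = X'"
proof (rule eq_matI)
  interpret pair: vector_space_pair "row_scale :: 'k \<Rightarrow> _" "row_scale :: 'k \<Rightarrow> _" ..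
  fix i j assume ij: "i < dim_row X'" "j < dim_col X'"
  let ?e = "\<lambda>l. of_bool (l = i) :: 'k"
  have "?e \<in> row.span B" using ij X' by (auto simp: B row_space_def)
  have "row_act X ?e = row_act X' ?e"
    by (rule pair.linear_eq_on_span[OF linear_row_act[OF field_hom_ident] linear_row_act[OF field_hom_ident] eq \<open>?e \<in> row.span B\<close>])
  then have "row_act X ?e j = row_act X' ?e j" by (rule fun_cong)
  then show "X $$ (i, j) = X' $$ (i, j)" using ij X X' by (simp add: row_act_unit)
qed (use X X' in auto)

text \<open>
  Extend \<open>B\<close> to a basis. A matrix is determined by its action on the basis, and as there are as
  many matrices as maps from the basis to the row space, the action on the basis is arbitrary.
\<close>

lemma card_matrices_prescribed_on_independent:
  fixes B :: "(nat \<Rightarrow> 'k::{field,finite}) set"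
  assumes B: "finite B" "row.independent B" "B \<subseteq> row_space c"
    and t: "\<And>v. v \<in> B \<Longrightarrow> t v \<in> row_space c"
  shows "card {X \<in> carrier_mat c c. \<forall>v\<in>B. row_act X v = t v} = CARD('k) ^ (c * (c - card B))"
proof -
  let ?V = "row_space c :: (nat \<Rightarrow> 'k) set"
  obtain B' where B': "B \<subseteq> B'" "B' \<subseteq> ?V" "row.independent B'" "?V \<subseteq> row.span B'"
    using B(3,2) by (rule row.maximal_independent_subset_extend)
  have fin: "finite B'" using B'(2) finite_row_space by (rule finite_subset)
  have "row.span B' \<subseteq> ?V"
    using B'(2) subspace_row_space[OF field_hom_ident] by (rule row.span_minimal)
  then have span: "row.span B' = ?V" using B'(4) by blast
  have "CARD('k) ^ card B' = CARD('k) ^ c"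
    using row.card_span_independent[OF fin B'(3)] by (simp only: span card_row_space)
  then have card_B': "card B' = c" using card_field_gt_1[where 'a = 'k] by (simp only: power_inject_exp)
  let ?h = "\<lambda>X. restrict (row_act X) B'"
  have inj: "inj_on ?h (carrier_mat c c)"
  proof (rule inj_onI)
    fix X X' :: "'k mat" assume X: "X \<in> carrier_mat c c" "X' \<in> carrier_mat c c" and eq: "?h X = ?h X'"
    show "X = X'" using X span
    proof (rule row_act_eqI)
      fix v assume "v \<in> B'"
      then show "row_act X v = row_act X' v" using fun_cong[OF eq, of v] by simp
    qed
  qed
  have "?h ` carrier_mat c c = (B' \<rightarrow>\<^sub>E ?V)"
  proof (rule card_subset_eq)
    show "finite (B' \<rightarrow>\<^sub>E ?V)" using fin finite_row_space by (intro finite_PiE)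
    show "?h ` carrier_mat c c \<subseteq> (B' \<rightarrow>\<^sub>E ?V)" by (auto intro: row_act_in_row_space)
    show "card (?h ` carrier_mat c c) = card (B' \<rightarrow>\<^sub>E ?V)"
      using fin by (simp add: card_image[OF inj] card_carrier_mat card_PiE card_row_space card_B' power_mult)
  qed
  then have bij: "bij_betw ?h (carrier_mat c c) (B' \<rightarrow>\<^sub>E ?V)" using inj by (simp add: bij_betw_def)
  let ?P = "\<Pi>\<^sub>E v\<in>B'. if v \<in> B then {t v} else ?V"
  have "bij_betw ?h {X \<in> carrier_mat c c. \<forall>v\<in>B. row_act X v = t v} ?P"
  proof (rule bij_betw_subset[OF bij])
    show "?h ` {X \<in> carrier_mat c c. \<forall>v\<in>B. row_act X v = t v} = ?P"
    proof (intro subset_antisym subsetI)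
      fix g assume g: "g \<in> ?P"
      have gt: "g v = t v" if "v \<in> B" for v using PiE_mem[OF g, of v] that B'(1) by auto
      have "g v \<in> ?V" if "v \<in> B'" for v
        using PiE_mem[OF g that] t[of v] by (cases "v \<in> B") simp_all
      moreover have "g \<in> extensional B'" using g by (simp only: PiE_iff)
      ultimately have "g \<in> B' \<rightarrow>\<^sub>E ?V" unfolding PiE_iff by blast
      then have "g \<in> ?h ` carrier_mat c c" using bij by (simp only: bij_betw_def)
      then obtain X where X: "g = ?h X" "X \<in> carrier_mat c c" by (rule imageE)
      have "row_act X v = t v" if "v \<in> B" for v
        using gt[OF that] that B'(1) by (auto simp: X(1) restrict_def split: if_splits)
      with X show "g \<in> ?h ` {X \<in> carrier_mat c c. \<forall>v\<in>B. row_act X v = t v}" by blast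
    qed (auto intro: row_act_in_row_space)
  qed auto
  then have "card {X \<in> carrier_mat c c. \<forall>v\<in>B. row_act X v = t v} = card ?P"
    by (rule bij_betw_same_card)
  also have "\<dots> = (\<Prod>v\<in>B'. if v \<in> B then 1 else CARD('k) ^ c)"
    using fin by (simp add: card_PiE if_distrib[of card] card_row_space cong: if_cong)
  also have "\<dots> = (CARD('k) ^ c) ^ card (B' - B)"
    using fin by (simp add: prod.If_cases Diff_eq)
  also have "card (B' - B) = c - card B" using B(1) B'(1) card_B' by (simp add: card_Diff_subset)
  finally show ?thesis
    by (simp add: power_mult)
qed

text \<open>
  The number of these tuples is the joint moment of the eigenspaces of \<open>X\<close> in which \<open>a\<close> has
  order \<open>count_list as a\<close>; see \<open>card_eigen_tuples\<close>. Lists rather than sets make the count a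
  recursion on \<open>as\<close>.
\<close>

definition eigen_tuples :: "'k::{field,finite} mat \<Rightarrow> 'k list \<Rightarrow> (nat \<Rightarrow> 'k) list set"
  where "eigen_tuples X as =
    {vs. list_all2 (\<lambda>v a. v \<in> eigenspace X a) vs as \<and> distinct vs \<and> row.independent (set vs)}"

lemma eigen_tuples_Nil: "eigen_tuples X [] = {[]}"
  by (auto simp: eigen_tuples_def row.independent_empty)

lemma eigen_tuples_Cons:
  "eigen_tuples X (a # as) =
    (\<lambda>(vs, v). v # vs) ` (SIGMA vs:eigen_tuples X as. eigenspace X a - row.span (set vs))"
  by (auto simp: eigen_tuples_def list_all2_Cons2 row.independent_insert image_iff row.span_base
      dest: row.dependent_insertD)

lemma finite_eigen_tuples:
  assumes "X \<in> carrier_mat c c"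
  shows "finite (eigen_tuples X as)"
  by (induction as) (use subspace_eigenspace(2)[OF assms] in \<open>auto simp: eigen_tuples_Nil eigen_tuples_Cons\<close>)

lemma eigenvalue_unique:
  fixes v :: "nat \<Rightarrow> 'k::{field,finite}"
  assumes "v \<in> eigenspace X a" "v \<in> eigenspace X b" "v \<noteq> 0"
  shows "a = b"
  using assms by (auto simp: eigenspace_def)

lemma card_eigenvectors_in_eigen_tuple:
  fixes X :: "'k::{field,finite} mat"
  assumes "vs \<in> eigen_tuples X as"
  shows "card {v \<in> set vs. v \<in> eigenspace X a} = count_list as a"
proof -
  have "list_all2 (\<lambda>v a. v \<in> eigenspace X a) vs as" "distinct vs" "0 \<notin> set vs"
    using assms row.dependent_zero by (auto simp: eigen_tuples_def)
  then show ?thesis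
  proof (induction rule: list_all2_induct)
    case (Cons v vs b as)
    have "v \<noteq> 0" using Cons.prems(2) by (metis list.set_intros(1))
    then have v: "v \<in> eigenspace X a \<longleftrightarrow> b = a" using Cons.hyps(1) eigenvalue_unique[of v X a b] by blast
    show ?case
    proof (cases "b = a")
      case True
      then have "{w \<in> set (v # vs). w \<in> eigenspace X a} = insert v {w \<in> set vs. w \<in> eigenspace X a}"
        using v by auto
      then show ?thesis using Cons True by simp
    next
      case False
      then have "{w \<in> set (v # vs). w \<in> eigenspace X a} = {w \<in> set vs. w \<in> eigenspace X a}" using v by auto
      then show ?thesis using Cons False by simp
    qed
  qed simp
qed

lemma card_eigenspace_Int_span_eigen_tuple:
  fixes X :: "'k::{field,finite} mat"
  assumes X: "X \<in> carrier_mat c c" and vs: "vs \<in> eigen_tuples X as"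
  shows "card (eigenspace X a \<inter> row.span (set vs)) = CARD('k) ^ count_list as a"
proof -
  interpret endomorphism row_scale "row_act X"
    by (intro endomorphism.intro endomorphism_axioms.intro vector_space_base_scale linear_row_act field_hom_ident)
  let ?B = "{v \<in> set vs. v \<in> eigenspace X a}"
  have ind: "row.independent (set vs)" and eig: "list_all2 (\<lambda>v a. v \<in> eigenspace X a) vs as"
    using vs by (auto simp: eigen_tuples_def)
  have "\<exists>b. v \<in> eigenspace X b" if "v \<in> set vs" for v
    using eig that by (auto simp: list_all2_conv_all_nth in_set_conv_nth)
  then obtain l where l: "\<And>v. v \<in> set vs \<Longrightarrow> v \<in> eigenspace X (l v)" by metis
  have "{v \<in> set vs. l v = a} \<subseteq> ?B" using l by auto
  moreover have "u \<in> row.span {v \<in> set vs. l v = a}" if "u \<in> eigenspace X a" "u \<in> row.span (set vs)" for u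
  proof (rule span_eigenvectors_Int_eigenspace[OF _ ind])
    show "row_act X v = row_scale (l v) v" if "v \<in> set vs" for v
      using l[OF that] by (simp add: eigenspace_def)
    show "row_act X u = row_scale a u" using that by (simp add: eigenspace_def)
  qed (use that in auto)
  ultimately have "eigenspace X a \<inter> row.span (set vs) \<subseteq> row.span ?B"
    using row.span_mono by blast
  moreover have "row.span ?B \<subseteq> eigenspace X a"
    using subspace_eigenspace(1)[OF X] by (intro row.span_minimal) auto
  moreover have "row.span ?B \<subseteq> row.span (set vs)" by (intro row.span_mono) auto
  ultimately have "eigenspace X a \<inter> row.span (set vs) = row.span ?B" by blast
  moreover have "row.independent ?B" using ind by (rule row.independent_mono) auto
  ultimately show ?thesis
    using row.card_span_independent[of ?B] card_eigenvectors_in_eigen_tuple[OF vs] by simp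
qed

text \<open>
  A new eigenvector for \<open>a\<close> has to avoid the span of the earlier vectors, and by
  \<open>span_eigenvectors_Int_eigenspace\<close> only those with eigenvalue \<open>a\<close> matter.
\<close>

lemma card_eigen_tuples_Cons:
  fixes X :: "'k::{field,finite} mat"
  assumes X: "X \<in> carrier_mat c c"
  shows "real (card (eigen_tuples X (a # as))) =
    real (card (eigen_tuples X as)) * (real (card (eigenspace X a)) - real CARD('k) ^ count_list as a)"
proof -
  have "card (eigen_tuples X (a # as))
      = card (SIGMA vs:eigen_tuples X as. eigenspace X a - row.span (set vs))"
    unfolding eigen_tuples_Cons by (rule card_image) (auto simp: inj_on_def)
  also have "\<dots> = (\<Sum>vs\<in>eigen_tuples X as. card (eigenspace X a - row.span (set vs)))"
    using finite_eigen_tuples[OF X] subspace_eigenspace(2)[OF X] by (intro card_SigmaI) auto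
  also have "real \<dots> = (\<Sum>vs\<in>eigen_tuples X as. real (card (eigenspace X a)) - real CARD('k) ^ count_list as a)"
    unfolding of_nat_sum
  proof (rule sum.cong[OF refl])
    fix vs assume vs: "vs \<in> eigen_tuples X as"
    have fin: "finite (eigenspace X a)" using subspace_eigenspace(2)[OF X] .
    have "card (eigenspace X a \<inter> row.span (set vs)) \<le> card (eigenspace X a)"
      using fin by (intro card_mono) auto
    with fin show "real (card (eigenspace X a - row.span (set vs)))
        = real (card (eigenspace X a)) - real CARD('k) ^ count_list as a"
      using card_eigenspace_Int_span_eigen_tuple[OF X vs, of a]
      by (simp add: card_Diff_subset_Int of_nat_diff)
  qed
  finally show ?thesis by simp
qed

lemma card_eigen_tuples:
  fixes X :: "'k::{field,finite} mat"
  assumes X: "X \<in> carrier_mat c c" and S: "finite S" "set as \<subseteq> S"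
  shows "real (card (eigen_tuples X as)) =
    (\<Prod>a\<in>S. q_falling (real CARD('k)) (real (card (eigenspace X a))) (count_list as a))"
  using S(2)
proof (induction as)
  case Nil
  then show ?case by (simp add: eigen_tuples_Nil)
next
  case (Cons a as)
  let ?q = "\<lambda>as b. q_falling (real CARD('k)) (real (card (eigenspace X b))) (count_list as b)"
  have a: "a \<in> S" using Cons.prems by simp
  have "(\<Prod>b\<in>S. ?q (a # as) b) = ?q (a # as) a * (\<Prod>b\<in>S - {a}. ?q (a # as) b)"
    using S(1) a by (rule prod.remove)
  also have "(\<Prod>b\<in>S - {a}. ?q (a # as) b) = (\<Prod>b\<in>S - {a}. ?q as b)" by (rule prod.cong) auto
  also have "?q (a # as) a * (\<Prod>b\<in>S - {a}. ?q as b)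
      = (\<Prod>b\<in>S. ?q as b) * (real (card (eigenspace X a)) - real CARD('k) ^ count_list as a)"
    by (simp add: prod.remove[OF S(1) a])
  finally show ?case using Cons by (simp add: card_eigen_tuples_Cons[OF X])
qed

definition independent_tuples :: "nat \<Rightarrow> nat \<Rightarrow> (nat \<Rightarrow> 'k::{field,finite}) list set"
  where "independent_tuples c m =
    {vs. length vs = m \<and> set vs \<subseteq> row_space c \<and> distinct vs \<and> row.independent (set vs)}"

lemma row_act_one_mat: "v \<in> row_space c \<Longrightarrow> row_act (1\<^sub>m c) v = v"
  by (auto simp: row_act_def row_space_def fun_eq_iff if_distrib[of "\<lambda>x. _ * x"] cong: if_cong)

text \<open>
  The whole row space is the eigenspace of the identity matrix for the eigenvalue \<open>1\<close>, so the count
  of eigenvector tuples also counts all independent tuples.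
\<close>

lemma independent_tuples_eq_eigen_tuples:
  "independent_tuples c m = eigen_tuples (1\<^sub>m c :: 'k::{field,finite} mat) (replicate m 1)"
proof -
  have "eigenspace (1\<^sub>m c) 1 = (row_space c :: (nat \<Rightarrow> 'k) set)"
    by (auto simp: eigenspace_def row_act_one_mat base_scale_def)
  then show ?thesis
    by (auto simp: independent_tuples_def eigen_tuples_def list_all2_conv_all_nth in_set_conv_nth subset_iff)
qed

lemma card_independent_tuples:
  "real (card (independent_tuples c m :: (nat \<Rightarrow> 'k::{field,finite}) list set)) =
    q_falling (real CARD('k)) (real CARD('k) ^ c) m"
  and finite_independent_tuples: "finite (independent_tuples c m :: (nat \<Rightarrow> 'k::{field,finite}) list set)"
proof -
  have one: "1\<^sub>m c \<in> (carrier_mat c c :: 'k mat set)" by simp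
  have "eigenspace (1\<^sub>m c) 1 = (row_space c :: (nat \<Rightarrow> 'k) set)"
    by (auto simp: eigenspace_def row_act_one_mat base_scale_def)
  moreover have "count_list (replicate m (1 :: 'k)) 1 = m" by (induction m) auto
  ultimately show "real (card (independent_tuples c m :: (nat \<Rightarrow> 'k) list set)) =
      q_falling (real CARD('k)) (real CARD('k) ^ c) m"
    unfolding independent_tuples_eq_eigen_tuples
    by (subst card_eigen_tuples[OF one, of "{1}"]) (auto simp: card_row_space)
  show "finite (independent_tuples c m :: (nat \<Rightarrow> 'k) list set)"
    unfolding independent_tuples_eq_eigen_tuples by (rule finite_eigen_tuples[OF one])
qed

text \<open>
  Double counting of the pairs of a matrix and an independent tuple of eigenvectors. Once the tuple is
  fixed, the condition on the matrix prescribes its action on \<open>length as\<close> independent vectors.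
\<close>

lemma sum_card_eigen_tuples:
  fixes as :: "'k::{field,finite} list"
  shows "(\<Sum>X\<in>carrier_mat c c. real (card (eigen_tuples X as))) =
    q_falling (real CARD('k)) (real CARD('k) ^ c) (length as) * real CARD('k) ^ (c * (c - length as))"
proof -
  let ?M = "carrier_mat c c :: 'k mat set" and ?I = "independent_tuples c (length as) :: (nat \<Rightarrow> 'k) list set"
  have finM: "finite ?M" by (rule finite_carrier_mat)
  have fin: "finite ?I" by (rule finite_independent_tuples)
  have sub: "eigen_tuples X as \<subseteq> ?I" if "X \<in> ?M" for X
    using that by (fastforce simp: eigen_tuples_def independent_tuples_def eigenspace_def
        list_all2_conv_all_nth in_set_conv_nth)
  have "(\<Sum>X\<in>?M. real (card (eigen_tuples X as))) = (\<Sum>X\<in>?M. \<Sum>vs\<in>?I. of_bool (vs \<in> eigen_tuples X as))"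
  proof (rule sum.cong[OF refl])
    fix X assume "X \<in> ?M"
    then have "?I \<inter> eigen_tuples X as = eigen_tuples X as" using sub by blast
    then show "real (card (eigen_tuples X as)) = (\<Sum>vs\<in>?I. of_bool (vs \<in> eigen_tuples X as))"
      using fin by simp
  qed
  also have "\<dots> = (\<Sum>vs\<in>?I. \<Sum>X\<in>?M. of_bool (vs \<in> eigen_tuples X as))" by (rule sum.swap)
  also have "\<dots> = (\<Sum>vs\<in>?I. real CARD('k) ^ (c * (c - length as)))"
  proof (rule sum.cong[OF refl])
    fix vs assume vs: "vs \<in> ?I"
    define t where "t v = row_scale (the (map_of (zip vs as) v)) v" for v
    have ind: "length vs = length as" "set vs \<subseteq> row_space c" "distinct vs" "row.independent (set vs)"
      using vs by (auto simp: independent_tuples_def)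
    have t: "t (vs ! i) = row_scale (as ! i) (vs ! i)" if "i < length as" for i
      using that ind by (simp add: t_def map_of_zip_nth)
    have mem: "vs ! i \<in> row_space c" if "i < length as" for i
      using that ind(1,2) nth_mem[of i vs] by auto
    have "vs \<in> eigen_tuples X as \<longleftrightarrow> (\<forall>v\<in>set vs. row_act X v = t v)" if "X \<in> ?M" for X
      using that ind(1,3,4) t mem
      by (auto simp: eigen_tuples_def eigenspace_def list_all2_conv_all_nth all_set_conv_all_nth)
    then have "{X \<in> ?M. vs \<in> eigen_tuples X as} = {X \<in> ?M. \<forall>v\<in>set vs. row_act X v = t v}" by blast
    moreover have "card {X \<in> ?M. \<forall>v\<in>set vs. row_act X v = t v} = CARD('k) ^ (c * (c - card (set vs)))"
    proof (rule card_matrices_prescribed_on_independent)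
      show "t v \<in> row_space c" if "v \<in> set vs" for v
        using ind(2) that by (auto simp: t_def row_space_def base_scale_def)
    qed (use ind in auto)
    ultimately have "card {X \<in> ?M. vs \<in> eigen_tuples X as} = CARD('k) ^ (c * (c - length as))"
      using ind by (simp add: distinct_card)
    moreover have "(\<Sum>X\<in>?M. of_bool (vs \<in> eigen_tuples X as)) = real (card {X \<in> ?M. vs \<in> eigen_tuples X as})"
      using finM by (simp add: Int_def)
    ultimately show "(\<Sum>X\<in>?M. of_bool (vs \<in> eigen_tuples X as)) = real CARD('k) ^ (c * (c - length as))"
      by simp
  qed
  finally show ?thesis by (simp add: card_independent_tuples)
qed

definition mat_average :: "nat \<Rightarrow> ('k::{field,finite} mat \<Rightarrow> real) \<Rightarrow> real"
  where "mat_average c g = (\<Sum>X\<in>carrier_mat c c. g X) / real (card (carrier_mat c c :: 'k mat set))"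

lemma ex_list_count:
  assumes "finite S"
  shows "\<exists>as. set as \<subseteq> S \<and> (\<forall>a\<in>S. count_list as a = m a) \<and> length as = (\<Sum>a\<in>S. m a)"
  using assms
proof (induction S)
  case (insert x S)
  then obtain as where as: "set as \<subseteq> S" "\<forall>a\<in>S. count_list as a = m a" "length as = (\<Sum>a\<in>S. m a)" by blast
  have rep: "count_list (replicate n x) a = (if a = x then n else 0)" for n a by (induction n) auto
  have "count_list as x = 0" using as(1) insert.hyps by (auto simp: count_list_0_iff)
  then show ?case using as insert.hyps
    by (intro exI[of _ "replicate (m x) x @ as"]) (auto simp: rep)
qed simp

lemma mat_average_prod_q_falling:
  fixes S :: "'k::{field,finite} set"
  defines "Q \<equiv> real CARD('k)"
  shows "mat_average c (\<lambda>X. \<Prod>a\<in>S. q_falling Q (real (card (eigenspace X a))) (m a)) =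
    (\<Prod>i<(\<Sum>a\<in>S. m a). 1 - Q ^ i / Q ^ c)"
proof -
  have S: "finite S" by simp
  obtain as where as: "set as \<subseteq> S" "\<And>a. a \<in> S \<Longrightarrow> count_list as a = m a" "length as = (\<Sum>a\<in>S. m a)"
    using ex_list_count[OF S] by blast
  define n where "n = length as"
  have Q: "Q > 1" using card_field_gt_1[where 'a = 'k] by (simp add: Q_def)
  have "(\<Sum>X\<in>carrier_mat c c. \<Prod>a\<in>S. q_falling Q (real (card (eigenspace X a))) (m a))
      = (\<Sum>X\<in>carrier_mat c c. real (card (eigen_tuples X as)))"
    by (intro sum.cong refl) (simp add: card_eigen_tuples[OF _ S as(1)] as(2) Q_def)
  also have "\<dots> = q_falling Q (Q ^ c) n * Q ^ (c * (c - n))"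
    by (simp only: sum_card_eigen_tuples Q_def n_def)
  also have "\<dots> / Q ^ (c * c) = (\<Prod>i<n. 1 - Q ^ i / Q ^ c)"
  proof (cases "n \<le> c")
    case True
    have "c * c = c * (c - n) + c * n" using True by (simp flip: distrib_left)
    then have "q_falling Q (Q ^ c) n * Q ^ (c * (c - n)) / Q ^ (c * c) = q_falling Q (Q ^ c) n / (Q ^ c) ^ n"
      using Q by (simp add: power_add power_mult)
    also have "\<dots> = (\<Prod>i<n. (Q ^ c - Q ^ i) / Q ^ c)" by (simp add: q_falling_def prod_dividef)
    also have "\<dots> = (\<Prod>i<n. 1 - Q ^ i / Q ^ c)" using Q by (simp add: diff_divide_distrib)
    finally show ?thesis .
  next
    case False
    then have "q_falling Q (Q ^ c) n = 0" by (auto simp: q_falling_def)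
    moreover have "(\<Prod>i<n. 1 - Q ^ i / Q ^ c) = 0" using False Q by (intro prod_zero bexI[of _ c]) auto
    ultimately show ?thesis by simp
  qed
  finally show ?thesis by (simp add: mat_average_def card_carrier_mat Q_def n_def as(3))
qed

section \<open>Averages over random matrices\<close>

lemma mat_average_cong:
  "(\<And>X. X \<in> carrier_mat c c \<Longrightarrow> g X = h X) \<Longrightarrow> mat_average c g = mat_average c h"
  unfolding mat_average_def by (simp cong: sum.cong)

lemma mat_average_diff: "mat_average c (\<lambda>X. g X - h X) = mat_average c g - mat_average c h"
  by (simp add: mat_average_def sum_subtractf diff_divide_distrib)

lemma mat_average_sum: "mat_average c (\<lambda>X. \<Sum>i\<in>I. g i X) = (\<Sum>i\<in>I. mat_average c (g i))"
  by (simp add: mat_average_def sum.swap[of _ I] sum_divide_distrib)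

lemma mat_average_mult_left: "mat_average c (\<lambda>X. r * g X) = r * mat_average c g"
  by (simp add: mat_average_def sum_distrib_left)

lemma mat_average_1: "mat_average c (\<lambda>X :: 'k::{field,finite} mat. 1) = 1"
  by (simp add: mat_average_def card_carrier_mat)

lemma mat_average_of_bool:
  fixes P :: "'k::{field,finite} mat \<Rightarrow> bool"
  shows "mat_average c (\<lambda>X. of_bool (P X)) =
    real (card {X \<in> carrier_mat c c. P X}) / real (card (carrier_mat c c :: 'k mat set))"
proof -
  have "finite (carrier_mat c c :: 'k mat set)" by (rule finite_carrier_mat)
  then show ?thesis by (simp add: mat_average_def Int_def)
qed

lemma geometric_rate_eigenspace_dimensions:
  fixes S :: "'k::{field,finite} set"
  defines "Q \<equiv> real CARD('k)"
  shows "geometric_rate Q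
    (\<lambda>c. mat_average c (\<lambda>X. \<Prod>a\<in>S. of_bool (card (eigenspace X a) = CARD('k) ^ \<kappa> a)))
    (\<Prod>a\<in>S. corank_limit Q (\<kappa> a))"
proof -
  have Q2: "Q \<ge> 2" using card_field_gt_1[where 'a = 'k] by (simp add: Q_def)
  have S: "finite S" by simp
  let ?x = "\<lambda>X a. real (card (eigenspace X a))"
  let ?v = "\<lambda>j. \<Prod>a\<in>S. inv_coeff Q (\<kappa> a) (j a)"
  have "mat_average c (\<lambda>X. \<Prod>a\<in>S. of_bool (card (eigenspace X a) = CARD('k) ^ \<kappa> a))
      = (\<Sum>j\<in>S \<rightarrow>\<^sub>E {..c}. ?v j * (\<Prod>i<(\<Sum>a\<in>S. \<kappa> a + j a). 1 - Q ^ i / Q ^ c))" for c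
  proof -
    have "(\<Prod>a\<in>S. of_bool (card (eigenspace X a) = CARD('k) ^ \<kappa> a))
        = (\<Sum>j\<in>S \<rightarrow>\<^sub>E {..c}. ?v j * (\<Prod>a\<in>S. q_falling Q (?x X a) (\<kappa> a + j a)))"
      if X: "X \<in> carrier_mat c c" for X :: "'k mat"
    proof -
      have "of_bool (card (eigenspace X a) = CARD('k) ^ \<kappa> a)
          = (\<Sum>j\<le>c. inv_coeff Q (\<kappa> a) j * q_falling Q (?x X a) (\<kappa> a + j))" for a
      proof -
        obtain d where d: "d \<le> c" "card (eigenspace X a) = CARD('k) ^ d"
          using card_eigenspace[OF X] by blast
        have "card (eigenspace X a) = CARD('k) ^ \<kappa> a \<longleftrightarrow> d = \<kappa> a"
          unfolding d(2) using card_field_gt_1[where 'a = 'k] by (rule power_inject_exp)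
        moreover have "?x X a = Q ^ d" by (simp add: d(2) Q_def)
        ultimately show ?thesis by (simp only: sum_inv_coeff_q_falling[OF Q2 d(1)])
      qed
      then show ?thesis using S by (simp add: prod_sum_PiE prod.distrib)
    qed
    then have "mat_average c (\<lambda>X. \<Prod>a\<in>S. of_bool (card (eigenspace X a) = CARD('k) ^ \<kappa> a))
        = mat_average c (\<lambda>X. \<Sum>j\<in>S \<rightarrow>\<^sub>E {..c}. ?v j * (\<Prod>a\<in>S. q_falling Q (?x X a) (\<kappa> a + j a)))"
      by (rule mat_average_cong)
    then show ?thesis
      unfolding mat_average_sum mat_average_mult_left Q_def mat_average_prod_q_falling .
  qed
  then show ?thesis by (simp only: geometric_rate_inverted_moments[OF Q2 S])
qed

text \<open>
  Here \<open>isolated f X\<close> indicates that exactly one point of \<open>R f\<close> is an eigenvalue of \<open>X\<close>, with a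
  one-dimensional eigenspace. The product over \<open>J\<close> is expanded one factor at a time. Each expansion
  prescribes the dimensions of the eigenspaces of all points of one more set \<open>R f\<close>, which is why the
  statement carries a set \<open>S\<close> of points with prescribed dimensions \<open>\<kappa>\<close>.
\<close>

lemma geometric_rate_no_isolated_eigenvalue:
  fixes R :: "'i \<Rightarrow> 'k::{field,finite} set"
  defines "Q \<equiv> real CARD('k)"
  defines "isolated \<equiv> \<lambda>f X. \<Sum>a\<in>R f. \<Prod>b\<in>R f. of_bool (card (eigenspace X b) = CARD('k) ^ of_bool (b = a)) :: real"
  assumes "finite J" "disjoint_family_on R J" "\<And>f. f \<in> J \<Longrightarrow> card (R f) = n"
    and "\<And>f. f \<in> J \<Longrightarrow> R f \<inter> S = {}"
  shows "geometric_rate Q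
    (\<lambda>c. mat_average c (\<lambda>X. (\<Prod>f\<in>J. 1 - isolated f X) *
      (\<Prod>a\<in>S. of_bool (card (eigenspace X a) = CARD('k) ^ \<kappa> a))))
    ((1 - real n * (corank_limit Q 1 * corank_limit Q 0 ^ (n - 1))) ^ card J *
      (\<Prod>a\<in>S. corank_limit Q (\<kappa> a)))"
  using assms(3-)
proof (induction J arbitrary: S \<kappa>)
  case empty
  then show ?case using geometric_rate_eigenspace_dimensions[where S = S and \<kappa> = \<kappa>] by (simp add: Q_def)
next
  case (insert f J)
  have Q2: "Q \<ge> 2" using card_field_gt_1[where 'a = 'k] by (simp add: Q_def)
  let ?p = "corank_limit Q" and ?x = "\<lambda>X a. card (eigenspace X a)"
  let ?L = "1 - real n * (?p 1 * ?p 0 ^ (n - 1))"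
  let ?T = "\<lambda>\<kappa> S X. \<Prod>a\<in>S. of_bool (?x X a = CARD('k) ^ \<kappa> a) :: real"
  let ?P = "\<lambda>X. \<Prod>g\<in>J. 1 - isolated g X"
  (* The dimensions prescribed on S \<union> R f when a is the isolated eigenvalue in R f. *)
  define \<kappa>' where "\<kappa>' a b = (if b \<in> R f then of_bool (b = a) else \<kappa> b)" for a b
  have disj: "R f \<inter> S = {}" and n: "card (R f) = n" using insert.prems by auto
  have disj_J: "R g \<inter> R f = {}" if "g \<in> J" for g
    using insert.prems(1) insert.hyps(2) that unfolding disjoint_family_on_def by (metis insertCI)
  have split: "prod h (S \<union> R f) = prod h (R f) * prod h S" for h :: "'k \<Rightarrow> real"
    using disj by (subst prod.union_disjoint) (auto simp: mult.commute)
  have T: "?T (\<kappa>' a) (S \<union> R f) X = (\<Prod>b\<in>R f. of_bool (?x X b = CARD('k) ^ of_bool (b = a))) * ?T \<kappa> S X"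
    for a and X :: "'k mat"
    unfolding split using disj by (intro arg_cong2[where f = "(*)"] prod.cong) (auto simp: \<kappa>'_def)
  have lim: "(\<Prod>b\<in>S \<union> R f. ?p (\<kappa>' a b)) = ?p 1 * ?p 0 ^ (n - 1) * (\<Prod>b\<in>S. ?p (\<kappa> b))"
    if a: "a \<in> R f" for a
  proof -
    have "(\<Prod>b\<in>R f. ?p (\<kappa>' a b)) = ?p (\<kappa>' a a) * (\<Prod>b\<in>R f - {a}. ?p (\<kappa>' a b))"
      using a by (intro prod.remove) auto
    also have "(\<Prod>b\<in>R f - {a}. ?p (\<kappa>' a b)) = (\<Prod>b\<in>R f - {a}. ?p 0)"
      by (intro prod.cong) (auto simp: \<kappa>'_def)
    also have "\<dots> = ?p 0 ^ (n - 1)" using a n by simp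
    also have "?p (\<kappa>' a a) = ?p 1" using a by (simp add: \<kappa>'_def)
    finally have "(\<Prod>b\<in>R f. ?p (\<kappa>' a b)) = ?p 1 * ?p 0 ^ (n - 1)" .
    moreover have "(\<Prod>b\<in>S. ?p (\<kappa>' a b)) = (\<Prod>b\<in>S. ?p (\<kappa> b))"
      using disj by (intro prod.cong) (auto simp: \<kappa>'_def)
    ultimately show ?thesis by (simp only: split)
  qed
  have IH: "geometric_rate Q (\<lambda>c. mat_average c (\<lambda>X. ?P X * ?T k U X)) (?L ^ card J * (\<Prod>a\<in>U. ?p (k a)))"
    if "\<And>g. g \<in> J \<Longrightarrow> R g \<inter> U = {}" for k U
    by (rule insert.IH) (use insert.prems that in \<open>auto intro: disjoint_family_on_mono[of J "insert f J"]\<close>)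
  have "(\<Prod>g\<in>insert f J. 1 - isolated g X) * ?T \<kappa> S X
      = ?P X * ?T \<kappa> S X - (\<Sum>a\<in>R f. ?P X * ?T (\<kappa>' a) (S \<union> R f) X)" for X
  proof -
    have "(\<Prod>g\<in>insert f J. 1 - isolated g X) * ?T \<kappa> S X = (1 - isolated f X) * ?P X * ?T \<kappa> S X"
      using insert.hyps by simp
    also have "\<dots> = ?P X * ?T \<kappa> S X - isolated f X * (?P X * ?T \<kappa> S X)" by (simp add: algebra_simps)
    also have "isolated f X * (?P X * ?T \<kappa> S X) = (\<Sum>a\<in>R f. ?P X * ?T (\<kappa>' a) (S \<union> R f) X)"
      unfolding isolated_def sum_distrib_right T by (intro sum.cong refl) (simp only: mult_ac)
    finally show ?thesis .
  qed
  then have eq: "mat_average c (\<lambda>X. (\<Prod>g\<in>insert f J. 1 - isolated g X) * ?T \<kappa> S X)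
      = mat_average c (\<lambda>X. ?P X * ?T \<kappa> S X)
        - (\<Sum>a\<in>R f. mat_average c (\<lambda>X. ?P X * ?T (\<kappa>' a) (S \<union> R f) X))" for c
    by (simp only: mat_average_diff mat_average_sum)
  have "geometric_rate Q (\<lambda>c. mat_average c (\<lambda>X. (\<Prod>g\<in>insert f J. 1 - isolated g X) * ?T \<kappa> S X))
      (?L ^ card J * (\<Prod>a\<in>S. ?p (\<kappa> a))
        - (\<Sum>a\<in>R f. ?L ^ card J * (\<Prod>b\<in>S \<union> R f. ?p (\<kappa>' a b))))"
    unfolding eq
    by (intro geometric_rate_diff[OF Q2] geometric_rate_sum[OF Q2] IH)
      (simp_all add: Int_Un_distrib disj_J insert.prems(3))
  also have "(\<Sum>a\<in>R f. ?L ^ card J * (\<Prod>b\<in>S \<union> R f. ?p (\<kappa>' a b)))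
      = (\<Sum>a\<in>R f. ?L ^ card J * (?p 1 * ?p 0 ^ (n - 1) * (\<Prod>b\<in>S. ?p (\<kappa> b))))"
    by (intro sum.cong refl) (simp only: lim)
  also have "\<dots> = real n * (?L ^ card J * (?p 1 * ?p 0 ^ (n - 1) * (\<Prod>b\<in>S. ?p (\<kappa> b))))"
    by (simp add: n)
  also have "?L ^ card J * (\<Prod>a\<in>S. ?p (\<kappa> a)) - \<dots> = ?L ^ card (insert f J) * (\<Prod>a\<in>S. ?p (\<kappa> a))"
    using insert.hyps by (simp add: algebra_simps)
  finally show ?case .
qed

section \<open>The proportion of primary cyclic matrices\<close>

lemma P_M_eq_mat_average:
  fixes \<iota> :: "'f::{field,finite} \<Rightarrow> 'k::{field,finite}"
  assumes \<iota>: "field_hom \<iota>" and card: "CARD('k) = CARD('f) ^ b" and c: "c > 0"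
  shows "P_M \<iota> b c = 1 - mat_average c (\<lambda>X. \<Prod>f\<in>{f. monic f \<and> irreducible f \<and> degree f = b}.
    1 - (\<Sum>a\<in>roots_in \<iota> f. \<Prod>a'\<in>roots_in \<iota> f.
      of_bool (card (eigenspace X a') = CARD('k) ^ of_bool (a' = a))))"
proof -
  let ?J = "{f :: 'f poly. monic f \<and> irreducible f \<and> degree f = b}"
  let ?C = "\<lambda>X f. primary_cyclic (base_scale \<iota>) (row_space c) (row_act X) f"
  have "?J \<subseteq> {p. degree p < Suc b}" by auto
  then have J: "finite ?J" using finite_polys_degree_less by (rule finite_subset)
  have "(\<Prod>f\<in>?J. 1 - (\<Sum>a\<in>roots_in \<iota> f. \<Prod>a'\<in>roots_in \<iota> f.
      of_bool (card (eigenspace X a') = CARD('k) ^ of_bool (a' = a))))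
      = 1 - (of_bool (\<exists>f\<in>?J. ?C X f) :: real)" if X: "X \<in> carrier_mat c c" for X
  proof -
    have "(\<Prod>f\<in>?J. 1 - (\<Sum>a\<in>roots_in \<iota> f. \<Prod>a'\<in>roots_in \<iota> f.
        of_bool (card (eigenspace X a') = CARD('k) ^ of_bool (a' = a)))) = (\<Prod>f\<in>?J. 1 - (of_bool (?C X f) :: real))"
    proof (rule prod.cong[OF refl])
      fix f assume "f \<in> ?J"
      then have "irreducible f" "monic f" "CARD('k) = CARD('f) ^ degree f" using card by auto
      from of_bool_primary_cyclic_row_act[OF \<iota> X c this]
      show "1 - (\<Sum>a\<in>roots_in \<iota> f. \<Prod>a'\<in>roots_in \<iota> f.
        of_bool (card (eigenspace X a') = CARD('k) ^ of_bool (a' = a))) = 1 - (of_bool (?C X f) :: real)"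
        by (simp only:)
    qed
    also have "\<dots> = 1 - of_bool (\<exists>f\<in>?J. ?C X f)"
      using J by (cases "\<exists>f\<in>?J. ?C X f") (auto simp: prod_zero_iff intro!: prod.neutral)
    finally show ?thesis .
  qed
  then have "mat_average c (\<lambda>X. \<Prod>f\<in>?J. 1 - (\<Sum>a\<in>roots_in \<iota> f. \<Prod>a'\<in>roots_in \<iota> f.
      of_bool (card (eigenspace X a') = CARD('k) ^ of_bool (a' = a))))
      = mat_average c (\<lambda>X. 1 - of_bool (\<exists>f\<in>?J. ?C X f))" by (rule mat_average_cong)
  also have "\<dots> = 1 - mat_average c (\<lambda>X. of_bool (\<exists>f\<in>?J. ?C X f))"
    by (simp only: mat_average_diff mat_average_1)
  also have "mat_average c (\<lambda>X. of_bool (\<exists>f\<in>?J. ?C X f)) = P_M \<iota> b c"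
    unfolding mat_average_of_bool P_M_def
    by (intro arg_cong2[where f = "(/)"] arg_cong[where f = "\<lambda>A. real (card A)"]) auto
  finally show ?thesis by simp
qed

lemma P_M_geometric_rate:
  fixes \<iota> :: "'f::{field,finite} \<Rightarrow> 'k::{field,finite}"
  assumes \<iota>: "field_hom \<iota>" and card: "CARD('k) = CARD('f) ^ b"
  defines "Q \<equiv> real CARD('k)"
  shows "\<exists>h. geometric_rate Q h (1 - (1 - (real b / Q) / (1 - 1 / Q)\<^sup>2 * omega 1 Q ^ b)
      ^ num_monic_irred TYPE('f) b) \<and> (\<forall>c>0. P_M \<iota> b c = h c)"
proof -
  let ?J = "{f :: 'f poly. monic f \<and> irreducible f \<and> degree f = b}"
  have Q2: "Q \<ge> 2" using card_field_gt_1[where 'a = 'k] by (simp add: Q_def)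
  have b: "b > 0"
  proof (rule ccontr)
    assume "\<not> b > 0"
    then show False using card card_field_gt_1[where 'a = 'k] by simp
  qed
  have "?J \<subseteq> {p. degree p < Suc b}" by auto
  then have J: "finite ?J" using finite_polys_degree_less by (rule finite_subset)
  define h where "h c = 1 - mat_average c (\<lambda>X :: 'k mat. (\<Prod>f\<in>?J.
    1 - (\<Sum>a\<in>roots_in \<iota> f. \<Prod>a'\<in>roots_in \<iota> f.
      of_bool (card (eigenspace X a') = CARD('k) ^ of_bool (a' = a)))) * 1)" for c
  have disj: "disjoint_family_on (roots_in \<iota>) ?J"
    unfolding disjoint_family_on_def using roots_in_disjoint[OF \<iota>] by blast
  have roots: "card (roots_in \<iota> f) = b" if "f \<in> ?J" for f
    using that card by (auto simp: card_roots_in[OF \<iota>])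
  have "geometric_rate (real CARD('k)) (\<lambda>c. mat_average c (\<lambda>X :: 'k mat. (\<Prod>f\<in>?J.
      1 - (\<Sum>a\<in>roots_in \<iota> f. \<Prod>a'\<in>roots_in \<iota> f.
        of_bool (card (eigenspace X a') = CARD('k) ^ of_bool (a' = a)))) *
      (\<Prod>a\<in>{}. of_bool (card (eigenspace X a) = CARD('k) ^ 0))))
    ((1 - real b * (corank_limit (real CARD('k)) 1 * corank_limit (real CARD('k)) 0 ^ (b - 1))) ^ card ?J *
      (\<Prod>a\<in>({} :: 'k set). corank_limit (real CARD('k)) 0))"
    by (rule geometric_rate_no_isolated_eigenvalue[OF J disj]) (erule roots, rule Int_empty_right)
  then have "geometric_rate Q h
    (1 - (1 - real b * (corank_limit Q 1 * corank_limit Q 0 ^ (b - 1))) ^ num_monic_irred TYPE('f) b)"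
    unfolding h_def num_monic_irred_def Q_def[symmetric] prod.empty mult_1_right
    by (intro geometric_rate_diff[OF Q2] geometric_rate_const[OF Q2])
  also have "real b * (corank_limit Q 1 * corank_limit Q 0 ^ (b - 1))
      = (real b / Q) / (1 - 1 / Q)\<^sup>2 * omega 1 Q ^ b"
    unfolding corank_limit_0[OF Q2] corank_limit_1[OF Q2]
    using b by (cases b) (auto simp: algebra_simps)
  finally show ?thesis
    using P_M_eq_mat_average[OF \<iota> card] by (auto simp: h_def)
qed

theorem theorem1p1:
  fixes q b :: nat
  assumes "CARD('f::{field,finite}) = q" and "CARD('k::{field,finite}) = q ^ b" and "b > 1"
  shows "\<exists>k :: real. \<forall>\<iota> :: 'f \<Rightarrow> 'k. field_hom \<iota> \<longrightarrow>
    (convergent (P_M \<iota> b) \<and>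
     P_M_inf \<iota> b =
       1 - (1 - (real b / real q ^ b) / (1 - 1 / real q ^ b)\<^sup>2 * omega 1 (real q ^ b) ^ b)
             ^ num_monic_irred TYPE('f) b) \<and>
    (\<forall>c>0. real c \<ge> (max (real b - 1) (real q ^ b / real b) / ln (3 / 4))\<^sup>2 \<longrightarrow>
       \<bar>P_M \<iota> b c - P_M_inf \<iota> b\<bar> < k / real q ^ (b * c))"
proof -
  define Q where "Q = real CARD('k)"
  define l where "l = 1 - (1 - (real b / Q) / (1 - 1 / Q)\<^sup>2 * omega 1 Q ^ b) ^ num_monic_irred TYPE('f) b"
  have Q: "real q ^ b = Q" by (simp add: Q_def assms(2))
  have Q2: "Q \<ge> 2" using card_field_gt_1[where 'a = 'k] by (simp add: Q_def)
  have card: "CARD('k) = CARD('f) ^ b" by (simp add: assms)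
  have "\<exists>C. field_hom \<iota> \<longrightarrow> P_M \<iota> b \<longlonglongrightarrow> l \<and> (\<forall>c>0. \<bar>P_M \<iota> b c - l\<bar> \<le> C / Q ^ c)" for \<iota> :: "'f \<Rightarrow> 'k"
  proof (cases "field_hom \<iota>")
    case True
    obtain h where h: "geometric_rate Q h l" "\<And>c. c > 0 \<Longrightarrow> P_M \<iota> b c = h c"
      using P_M_geometric_rate[OF True card] unfolding Q_def l_def by blast
    have "eventually (\<lambda>c. h c = P_M \<iota> b c) sequentially"
      using eventually_gt_at_top[of 0] by eventually_elim (simp add: h(2))
    with geometric_rate_tendsto[OF Q2 h(1)] have "P_M \<iota> b \<longlonglongrightarrow> l" by (rule Lim_transform_eventually)
    moreover obtain C where "\<And>c. \<bar>h c - l\<bar> \<le> C / Q ^ c"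
      using h(1) by (auto simp: geometric_rate_def)
    then have "\<forall>c>0. \<bar>P_M \<iota> b c - l\<bar> \<le> C / Q ^ c" by (simp add: h(2))
    ultimately show ?thesis by blast
  qed simp
  then obtain C where C: "\<And>\<iota> :: 'f \<Rightarrow> 'k. field_hom \<iota> \<Longrightarrow> P_M \<iota> b \<longlonglongrightarrow> l"
      "\<And>(\<iota> :: 'f \<Rightarrow> 'k) c. field_hom \<iota> \<Longrightarrow> c > 0 \<Longrightarrow> \<bar>P_M \<iota> b c - l\<bar> \<le> C \<iota> / Q ^ c" by metis
  (* There are finitely many maps between the two fields, so one constant serves all embeddings;
     the summand 1 makes the estimate strict. *)
  define k where "k = (\<Sum>\<iota>\<in>UNIV. \<bar>C \<iota>\<bar>) + 1"
  show ?thesis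
  proof (intro exI[of _ k] allI impI conjI)
    fix \<iota> :: "'f \<Rightarrow> 'k" and c :: nat
    assume \<iota>: "field_hom \<iota>"
    show "convergent (P_M \<iota> b)" using C(1)[OF \<iota>] by (rule convergentI)
    have inf: "P_M_inf \<iota> b = l" unfolding P_M_inf_def using C(1)[OF \<iota>] by (rule limI)
    then show "P_M_inf \<iota> b =
       1 - (1 - (real b / real q ^ b) / (1 - 1 / real q ^ b)\<^sup>2 * omega 1 (real q ^ b) ^ b)
             ^ num_monic_irred TYPE('f) b" by (simp only: l_def Q)
    assume c: "c > 0"
    have "\<bar>C \<iota>\<bar> \<le> (\<Sum>\<iota>\<in>UNIV. \<bar>C \<iota>\<bar>)" by (rule member_le_sum) auto
    then have "C \<iota> < k" by (simp add: k_def)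
    then have "C \<iota> / Q ^ c < k / Q ^ c" using Q2 by (intro divide_strict_right_mono) auto
    with C(2)[OF \<iota> c] show "\<bar>P_M \<iota> b c - P_M_inf \<iota> b\<bar> < k / real q ^ (b * c)"
      by (simp add: inf power_mult Q)
  qed
qed

end
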